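(* Let $H=0$ be the DAE of size $N$ obtained from a code-list of an ODE $\dot x=f(t,x)$ of size $n$ by an arbitrary set of sub-ODE replacements, as defined in the context, and let $\Sigma=(\sigma_{ij})$ be its $N\times N$ signature matrix. Define offset vectors $c=(c_1,\dots,c_N)$, $d=(d_1,\dots,d_N)$ by $$d_j=1\ \text{ for all } j,\qquad c_i=\begin{cases}0 & \text{if } i \text{ is an ODE row or a sub-ODE row},\\ 1 & \text{if } i\text{ is an ordinary row.}\end{cases}$$ Then: (i) These offsets are valid and normalised. (ii) The main diagonal is a highest-value transversal of $\Sigma$. (iii) The system Jacobian $\mathbf{J}$ defined by these offsets is unit lower triangular, hence nonsingular. (iv) Hence any DAE $G=0$ derived from (a code-list of) an ODE, with an arbitrary set of sub-ODE replacements giving $H=0$, is structurally amenable.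
   Context: Code-list. The ODE $\dot x=f(t,x)$ has $n\ge1$ state variables $x_1,\dots,x_n$, and $x_{n+1}$ is an alias for $t$. A code-list consists of intermediate variables $x_{n+2},\dots,x_N$, a relation $\prec$ on $\{1,\dots,N\}$ ("$i\prec j$" means "$x_i$ is used by $x_j$"), scalar functions $\phi_{n+2},\dots,\phi_N$ giving assignments $x_j=\phi_j(x_{\prec j})$ for $j=n+2,\dots,N$, where $x_{\prec j}$ is the vector of those $x_i$ with $i\prec j$ (possibly empty, and empty for $j\le n+1$), and output indices $\mathrm{out}(1),\dots,\mathrm{out}(n)\in\{1,\dots,N\}$ such that the ODE is $\dot x_i=\widehat{x}_i:=x_{\mathrm{out}(i)}$, $i=1,\dots,n$. The code-list is sound: $i\prec j$ implies $i<j$. All functions are suitably smooth. DAE $G=0$. The code-list gives the DAE $G=0$ of size $N$ in $x_1,\dots,x_N$: $G_i=\dot x_i-x_{\mathrm{out}(i)}$ for $i=1,\dots,n$; $G_{n+1}=x_{n+1}-t$; $G_i=x_i-\phi_i(x_{\prec i})$ for $i=n+2,\dots,N$. Sub-ODE replacements. Choose any collection of pairwise disjoint contiguous blocks $J=\{j^*+1,\dots,j^*+m\}\subseteq\{n+2,\dots,N\}$ ($m\ge1$ may depend on $J$) such that the assignments for $j\in J$ together form a vector assignment $x_J=g(x_{i(J)})$, where $x_J=(x_j)_{j\in J}$, $g$ is an $m$-vector function of a scalar, and for every $j\in J$ the only index $k$ with $k\prec j$ is $k=i(J)$ (so $i(J)<j$ for all $j\in J$). Suppose there is an $m$-vector function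 $h(u,v)$ of scalar $u$ and $m$-vector $v$ with $g'(u)=h(u,g(u))$; label its components $\chi_j$, $j\in J$. Replace the assignment $v=g(u)$ by the sub-ODE $\dot v=h(u,v)\dot u$, i.e. form the DAE $H=0$ with $H_j=\dot x_j-\chi_j(x_{i},x_J)\,\dot x_{i}$ for $j\in J$, $i=i(J)$, for each chosen block $J$; $H_j=G_j$ for $j$ outside every chosen block. Rows $1,\dots,n$ are ODE rows; rows in the chosen blocks are sub-ODE rows; all other rows are ordinary rows. Signature matrix: $\sigma_{ij}$ is the highest order of derivative of $x_j$ occurring in $H_i$ (the 0th derivative being $x_j$ itself), or $-\infty$ if $x_j$ does not occur in $H_i$. A transversal is a set $\mathcal{T}$ of $N$ positions $(i,j)$ with exactly one in each row and each column; its value is $\sum_{(i,j)\in\mathcal{T}}\sigma_{ij}$; a highest-value transversal is one of largest (finite) value. Offsets $(c,d)$ (integer $N$-vectors) are valid if $d_j-c_i\ge\sigma_{ij}$ for all $i,j$, with equality for all $(i,j)$ on some transversal; normalised if $\min_i c_i=0$. The system Jacobian of valid offsets is the $N\times N$ matrix with $\mathbf{J}_{ij}=\partial H_i/\partial x_j^{(\sigma_{ij})}$ if $d_j-c_i=\sigma_{ij}$, and $0$ otherwise. A DAE is structurally amenable if it has valid offsets for which $\mathbf{J}$ is nonsingular somewhere, i.e. at some consistent point of the DAE (a point lying on a solution path). *)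

theory Defs
  imports "HOL-Analysis.Analysis" "Jordan_Normal_Form.Matrix"
begin

text \<open>
  Variables and equations are indexed by natural numbers starting from 1.  A vector
  \<open>(x\<^sub>i)\<^sub>i\<^sub>\<in>\<^sub>I\<close> over a finite index set \<open>I\<close> is an extensional function, i.e. a
  point of \<open>powertop_real I\<close>; \<open>restrict x I\<close> is the subvector of \<open>x\<close> selected by \<open>I\<close>.
\<close>

section \<open>Smooth scalar functions\<close>

definition partial :: "nat \<Rightarrow> ((nat \<Rightarrow> real) \<Rightarrow> real) \<Rightarrow> (nat \<Rightarrow> real) \<Rightarrow> real" where
  "partial i \<phi> y = deriv (\<lambda>s. \<phi> (y(i := s))) (y i)"

text \<open>The class \<open>C\<^sup>k\<close> on an open subset \<open>D\<close> of the real space with index set \<open>I\<close>.\<close>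

primrec cont_diff :: "nat \<Rightarrow> nat set \<Rightarrow> (nat \<Rightarrow> real) set \<Rightarrow> ((nat \<Rightarrow> real) \<Rightarrow> real) \<Rightarrow> bool" where
  "cont_diff 0 I D \<phi> \<longleftrightarrow>
     continuous_map (subtopology (powertop_real I) D) euclideanreal \<phi>"
| "cont_diff (Suc k) I D \<phi> \<longleftrightarrow>
     continuous_map (subtopology (powertop_real I) D) euclideanreal \<phi> \<and>
     (\<forall>i\<in>I. (\<forall>y\<in>D. (\<lambda>s. \<phi> (y(i := s))) differentiable at (y i)) \<and>
            cont_diff k I D (partial i \<phi>))"

definition smooth :: "nat set \<Rightarrow> (nat \<Rightarrow> real) set \<Rightarrow> ((nat \<Rightarrow> real) \<Rightarrow> real) \<Rightarrow> bool" where
  "smooth I D \<phi> \<longleftrightarrow> openin (powertop_real I) D \<and> (\<forall>k. cont_diff k I D \<phi>)"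


section \<open>Differential-algebraic equations and their signature\<close>

text \<open>
  A jet \<open>z\<close> assigns to \<open>j\<close> and \<open>k\<close> the value \<open>z j k\<close> of the \<open>k\<close>-th derivative of \<open>x\<^sub>j\<close>.
  Equation \<open>i\<close> is \<open>dae_eqn F i (t, z) = 0\<close>; its left-hand side is meaningful only on
  \<open>dae_dom F i\<close>.
\<close>

type_synonym jet = "nat \<Rightarrow> nat \<Rightarrow> real"

record dae =
  dae_size :: nat
  dae_dom :: "nat \<Rightarrow> (real \<times> jet) set"
  dae_eqn :: "nat \<Rightarrow> real \<times> jet \<Rightarrow> real"

definition dae_domain :: "dae \<Rightarrow> (real \<times> jet) set" where
  "dae_domain F = {p. \<forall>i\<in>{1..dae_size F}. p \<in> dae_dom F i}"

definition set_deriv :: "real \<times> jet \<Rightarrow> nat \<Rightarrow> nat \<Rightarrow> real \<Rightarrow> real \<times> jet" where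
  "set_deriv p j k s = (fst p, (snd p)(j := (snd p j)(k := s)))"

text \<open>
  Occurrence means genuine dependence: changing only the \<open>k\<close>-th derivative of \<open>x\<^sub>j\<close>
  can change the value of the left-hand side.
\<close>

definition occurs :: "dae \<Rightarrow> nat \<Rightarrow> nat \<Rightarrow> nat \<Rightarrow> bool" where
  "occurs F i j k \<longleftrightarrow>
     (\<exists>p s. p \<in> dae_dom F i \<and> set_deriv p j k s \<in> dae_dom F i \<and>
            dae_eqn F i (set_deriv p j k s) \<noteq> dae_eqn F i p)"

text \<open>The supremum of the empty set is \<open>-\<infinity>\<close> in \<^typ>\<open>ereal\<close>.\<close>

definition signature :: "dae \<Rightarrow> nat \<Rightarrow> nat \<Rightarrow> ereal" where
  "signature F i j = (SUP k\<in>{k. occurs F i j k}. ereal (real k))"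

definition transversal :: "nat \<Rightarrow> (nat \<times> nat) set \<Rightarrow> bool" where
  "transversal N T \<longleftrightarrow> T \<subseteq> {1..N} \<times> {1..N} \<and>
     (\<forall>i\<in>{1..N}. \<exists>!j. (i, j) \<in> T) \<and> (\<forall>j\<in>{1..N}. \<exists>!i. (i, j) \<in> T)"

definition transversal_value :: "dae \<Rightarrow> (nat \<times> nat) set \<Rightarrow> ereal" where
  "transversal_value F T = (\<Sum>(i, j)\<in>T. signature F i j)"

definition highest_value_transversal :: "dae \<Rightarrow> (nat \<times> nat) set \<Rightarrow> bool" where
  "highest_value_transversal F T \<longleftrightarrow>
     transversal (dae_size F) T \<and> \<bar>transversal_value F T\<bar> \<noteq> \<infinity> \<and>
     (\<forall>T'. transversal (dae_size F) T' \<longrightarrow> transversal_value F T' \<le> transversal_value F T)"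

definition valid_offsets :: "dae \<Rightarrow> (nat \<Rightarrow> int) \<Rightarrow> (nat \<Rightarrow> int) \<Rightarrow> bool" where
  "valid_offsets F c d \<longleftrightarrow>
     (\<forall>i\<in>{1..dae_size F}. \<forall>j\<in>{1..dae_size F}. signature F i j \<le> ereal (of_int (d j - c i))) \<and>
     (\<exists>T. transversal (dae_size F) T \<and>
          (\<forall>(i, j)\<in>T. signature F i j = ereal (of_int (d j - c i))))"

definition normalised_offsets :: "dae \<Rightarrow> (nat \<Rightarrow> int) \<Rightarrow> bool" where
  "normalised_offsets F c \<longleftrightarrow> Min (c ` {1..dae_size F}) = 0"

definition dae_partial :: "dae \<Rightarrow> nat \<Rightarrow> nat \<Rightarrow> nat \<Rightarrow> real \<times> jet \<Rightarrow> real" where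
  "dae_partial F i j k p = deriv (\<lambda>s. dae_eqn F i (set_deriv p j k s)) (snd p j k)"

text \<open>
  Library matrices are indexed from 0, whence the shift.  In the first case
  \<open>d\<^sub>j - c\<^sub>i\<close> equals \<open>\<sigma>\<^sub>i\<^sub>j\<close> and so is a natural number.
\<close>

definition system_jacobian ::
    "dae \<Rightarrow> (nat \<Rightarrow> int) \<Rightarrow> (nat \<Rightarrow> int) \<Rightarrow> real \<times> jet \<Rightarrow> real mat" where
  "system_jacobian F c d p = mat (dae_size F) (dae_size F) (\<lambda>(i', j').
     let i = Suc i'; j = Suc j' in
     if ereal (of_int (d j - c i)) = signature F i j
     then dae_partial F i j (nat (d j - c i)) p else 0)"

definition unit_lower_triangular :: "real mat \<Rightarrow> bool" where
  "unit_lower_triangular A \<longleftrightarrow> square_mat A \<and>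
     (\<forall>i<dim_row A. A $$ (i, i) = 1 \<and> (\<forall>j<dim_col A. i < j \<longrightarrow> A $$ (i, j) = 0))"

definition jet_of :: "(nat \<Rightarrow> real \<Rightarrow> real) \<Rightarrow> real \<Rightarrow> jet" where
  "jet_of X t = (\<lambda>j k. (deriv ^^ k) (X j) t)"

definition dae_solution :: "dae \<Rightarrow> real set \<Rightarrow> (nat \<Rightarrow> real \<Rightarrow> real) \<Rightarrow> bool" where
  "dae_solution F I X \<longleftrightarrow> open I \<and> is_interval I \<and> I \<noteq> {} \<and>
     (\<forall>j\<in>{1..dae_size F}. \<forall>k. \<forall>t\<in>I. (deriv ^^ k) (X j) differentiable at t) \<and>
     (\<forall>t\<in>I. (t, jet_of X t) \<in> dae_domain F \<and>
        (\<forall>i\<in>{1..dae_size F}. dae_eqn F i (t, jet_of X t) = 0))"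

definition consistent_point :: "dae \<Rightarrow> real \<times> jet \<Rightarrow> bool" where
  "consistent_point F p \<longleftrightarrow> (\<exists>I X. dae_solution F I X \<and> (\<exists>t\<in>I. p = (t, jet_of X t)))"

definition structurally_amenable :: "dae \<Rightarrow> bool" where
  "structurally_amenable F \<longleftrightarrow>
     (\<exists>c d. valid_offsets F c d \<and>
        (\<exists>p. consistent_point F p \<and> invertible_mat (system_jacobian F c d p)))"


section \<open>Code-lists\<close>

text \<open>
  \<open>cl_dom C j\<close> is the domain of the elementary function \<open>cl_fun C j\<close>
  (think of \<open>ln\<close> or division).
\<close>

record code_list =
  cl_n :: nat
  cl_N :: nat
  cl_uses :: "nat \<Rightarrow> nat \<Rightarrow> bool"
  cl_fun :: "nat \<Rightarrow> (nat \<Rightarrow> real) \<Rightarrow> real"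
  cl_dom :: "nat \<Rightarrow> (nat \<Rightarrow> real) set"
  cl_out :: "nat \<Rightarrow> nat"

definition cl_args :: "code_list \<Rightarrow> nat \<Rightarrow> nat set" where
  "cl_args C j = {i. cl_uses C i j}"

definition code_list :: "code_list \<Rightarrow> bool" where
  "code_list C \<longleftrightarrow> 1 \<le> cl_n C \<and> cl_n C + 1 \<le> cl_N C \<and>
     (\<forall>i j. cl_uses C i j \<longrightarrow> i \<in> {1..cl_N C} \<and> j \<in> {cl_n C + 2..cl_N C} \<and> i < j) \<and>
     (\<forall>j\<in>{cl_n C + 2..cl_N C}. smooth (cl_args C j) (cl_dom C j) (cl_fun C j)) \<and>
     (\<forall>i\<in>{1..cl_n C}. cl_out C i \<in> {1..cl_N C})"

text \<open>
  \<open>C\<close> is a code-list of the ODE \<open>x' = f(t, x)\<close> posed on the nonempty open set \<open>\<Omega>\<close>: for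
  every \<open>(t, x) \<in> \<Omega>\<close> executing the assignments stays in the domains of the elementary
  functions and the outputs are the components of \<open>f(t, x)\<close>.  Here \<open>v\<close> is the vector
  of all \<open>N\<close> values, which the assignments determine uniquely.
\<close>

definition code_list_of_ode ::
    "code_list \<Rightarrow> (real \<times> (nat \<Rightarrow> real)) set \<Rightarrow> (real \<Rightarrow> (nat \<Rightarrow> real) \<Rightarrow> nat \<Rightarrow> real) \<Rightarrow> bool" where
  "code_list_of_ode C \<Omega> f \<longleftrightarrow> code_list C \<and>
     openin (prod_topology euclideanreal (powertop_real {1..cl_n C})) \<Omega> \<and> \<Omega> \<noteq> {} \<and>
     (\<forall>(t, x)\<in>\<Omega>. \<exists>v.
        (\<forall>i\<in>{1..cl_n C}. v i = x i) \<and> v (cl_n C + 1) = t \<and>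
        (\<forall>j\<in>{cl_n C + 2..cl_N C}. restrict v (cl_args C j) \<in> cl_dom C j \<and>
           v j = cl_fun C j (restrict v (cl_args C j))) \<and>
        (\<forall>i\<in>{1..cl_n C}. f t x i = v (cl_out C i)))"

definition code_list_dae :: "code_list \<Rightarrow> dae" where
  "code_list_dae C = \<lparr>
     dae_size = cl_N C,
     dae_dom = (\<lambda>i. if i \<le> cl_n C + 1 then UNIV
        else {(t, z). restrict (\<lambda>j. z j 0) (cl_args C i) \<in> cl_dom C i}),
     dae_eqn = (\<lambda>i (t, z).
        if i \<le> cl_n C then z i 1 - z (cl_out C i) 0
        else if i = cl_n C + 1 then z i 0 - t
        else z i 0 - cl_fun C i (restrict (\<lambda>j. z j 0) (cl_args C i))) \<rparr>"


section \<open>Sub-ODE replacements\<close>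

text \<open>
  For a chosen block \<open>J\<close> the function \<open>h(u, v)\<close> takes a vector indexed by
  \<open>insert (r_arg R J) J\<close>: the coordinate \<open>r_arg R J\<close> holds the scalar \<open>u\<close>, and the
  coordinates in \<open>J\<close> hold \<open>v\<close>.  Its component belonging to \<open>j \<in> J\<close> is \<open>r_fun R j\<close>, and
  its domain is \<open>r_dom R J\<close>.
\<close>

record replacement =
  r_blocks :: "nat set set"
  r_arg :: "nat set \<Rightarrow> nat"
  r_fun :: "nat \<Rightarrow> (nat \<Rightarrow> real) \<Rightarrow> real"
  r_dom :: "nat set \<Rightarrow> (nat \<Rightarrow> real) set"

definition scalar_arg :: "replacement \<Rightarrow> nat set \<Rightarrow> real \<Rightarrow> nat \<Rightarrow> real" where
  "scalar_arg R J u = restrict (\<lambda>_. u) {r_arg R J}"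

text \<open>The point \<open>(u, g(u))\<close>, where \<open>g\<close> is the vector function assigned to the block \<open>J\<close>.\<close>

definition block_graph :: "code_list \<Rightarrow> replacement \<Rightarrow> nat set \<Rightarrow> real \<Rightarrow> nat \<Rightarrow> real" where
  "block_graph C R J u = (\<lambda>k\<in>insert (r_arg R J) J.
     if k = r_arg R J then u else cl_fun C k (scalar_arg R J u))"

definition sub_ode_replacement :: "code_list \<Rightarrow> replacement \<Rightarrow> bool" where
  "sub_ode_replacement C R \<longleftrightarrow>
     pairwise disjnt (r_blocks R) \<and>
     (\<forall>J\<in>r_blocks R.
        (\<exists>s m. 1 \<le> m \<and> J = {s + 1..s + m}) \<and> J \<subseteq> {cl_n C + 2..cl_N C} \<and>
        (\<forall>j\<in>J. cl_args C j = {r_arg R J}) \<and>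
        (\<forall>j\<in>J. smooth (insert (r_arg R J) J) (r_dom R J) (r_fun R j)) \<and>
        (\<forall>u. (\<forall>j\<in>J. scalar_arg R J u \<in> cl_dom C j) \<longrightarrow>
           block_graph C R J u \<in> r_dom R J \<and>
           (\<forall>j\<in>J. ((\<lambda>s. cl_fun C j (scalar_arg R J s)) has_real_derivative
                    r_fun R j (block_graph C R J u)) (at u))))"

definition sub_ode_rows :: "replacement \<Rightarrow> nat set" where
  "sub_ode_rows R = \<Union> (r_blocks R)"

definition ode_rows :: "code_list \<Rightarrow> nat set" where
  "ode_rows C = {1..cl_n C}"

definition block_of :: "replacement \<Rightarrow> nat \<Rightarrow> nat set" where
  "block_of R j = (THE J. J \<in> r_blocks R \<and> j \<in> J)"

definition block_vars :: "replacement \<Rightarrow> nat set \<Rightarrow> jet \<Rightarrow> nat \<Rightarrow> real" where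
  "block_vars R J z = restrict (\<lambda>k. z k 0) (insert (r_arg R J) J)"

definition sub_ode_dae :: "code_list \<Rightarrow> replacement \<Rightarrow> dae" where
  "sub_ode_dae C R = \<lparr>
     dae_size = cl_N C,
     dae_dom = (\<lambda>j. if j \<in> sub_ode_rows R
        then {(t, z). block_vars R (block_of R j) z \<in> r_dom R (block_of R j)}
        else dae_dom (code_list_dae C) j),
     dae_eqn = (\<lambda>j (t, z). if j \<in> sub_ode_rows R
        then z j 1 - r_fun R j (block_vars R (block_of R j) z) * z (r_arg R (block_of R j)) 1
        else dae_eqn (code_list_dae C) j (t, z)) \<rparr>"

end

(*
  Every row of Sigma is bounded by d_j - c_i = 1 - c_i, and the bound is attained on the diagonal but
  never above it: ODE and sub-ODE rows contain x_i', ordinary rows contain x_i, and the remaining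
  variables that occur to the same order have smaller index because the code-list is sound.
  This gives (i)-(iii).

  For (iv) a consistent point is needed, that is, a smooth solution of H = 0.  Executing the code-list
  near a point of Omega is locally Lipschitz, by induction along the list, since C^1 functions are.
  Picard iteration for the autonomous system with t adjoined as x_{n+1} then yields a solution on an
  open interval.  It is smooth by bootstrapping: if the state variables are k times differentiable, so
  are all x_j by the chain rule, hence so are the derivatives x_i' = x_out(i).  The sub-ODE rows hold
  by the chain rule applied to x_J = g(x_i).
*)
theory Submission
  imports Defs "Jordan_Normal_Form.Determinant"
begin

section \<open>Strict differentiability of C^1 functions, with local Lipschitz bounds and the chain
  rule\<close>

section \<open>Continuously differentiable functions of finitely many variables\<close>

text \<open>Open max-norm cube about \<open>y\<close>. Its points are extensional because the space
  of \<open>powertop_real I\<close> consists of extensional functions; for finite \<open>I\<close>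
  such cubes form a neighbourhood base.\<close>

definition ebox :: "nat set \<Rightarrow> (nat \<Rightarrow> real) \<Rightarrow> real \<Rightarrow> (nat \<Rightarrow> real) set" where
  "ebox I y e = {u \<in> extensional I. \<forall>i\<in>I. \<bar>u i - y i\<bar> < e}"

lemma ebox_mono: "e \<le> e' \<Longrightarrow> ebox I y e \<subseteq> ebox I y e'"
  by (force simp: ebox_def)

lemma ebox_update: "u \<in> ebox I y e \<Longrightarrow> i \<in> I \<Longrightarrow> \<bar>s - y i\<bar> < e \<Longrightarrow> u(i := s) \<in> ebox I y e"
  by (auto simp: ebox_def extensional_def)

lemma openin_powertop_ebox:
  assumes "openin (powertop_real I) D" "finite I" "y \<in> D"
  obtains e where "e > 0" "ebox I y e \<subseteq> D"
proof -
  obtain U where U: "\<And>i. i \<in> I \<Longrightarrow> open (U i)" "y \<in> Pi\<^sub>E I U" "Pi\<^sub>E I U \<subseteq> D"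
    using assms(1,3) unfolding openin_product_topology_alt by (metis open_openin)
  have "\<exists>e>0. \<forall>s. \<bar>s - y i\<bar> < e \<longrightarrow> s \<in> U i" if "i \<in> I" for i
    using U(1)[OF that] U(2) that unfolding open_dist by (auto simp: dist_real_def)
  then obtain e where e: "\<And>i. i \<in> I \<Longrightarrow> e i > 0" 
      "\<And>i s. i \<in> I \<Longrightarrow> \<bar>s - y i\<bar> < e i \<Longrightarrow> s \<in> U i"
    by metis
  \<comment> \<open>The inserted 1 keeps the minimum meaningful when \<open>I\<close> is empty, as
    happens for an assignment without arguments.\<close>
  define m where "m = Min (insert 1 (e ` I))"
  have "m > 0" using assms(2) e(1) by (auto simp: m_def)
  moreover have "ebox I y m \<subseteq> D"
  proof
    fix u assume u: "u \<in> ebox I y m"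
    have "u i \<in> U i" if "i \<in> I" for i
    proof -
      have "m \<le> e i" using that assms(2) by (auto simp: m_def)
      then show ?thesis using u e(2) that by (fastforce simp: ebox_def)
    qed
    then have "u \<in> Pi\<^sub>E I U" using u by (auto simp: ebox_def PiE_def)
    then show "u \<in> D" using U(3) by blast
  qed
  ultimately show ?thesis by (rule that)
qed

lemma continuous_map_ebox:
  assumes "continuous_map (subtopology (powertop_real I) D) euclideanreal g"
    and "openin (powertop_real I) D" "finite I" "y \<in> D" "e > 0"
  obtains d where "d > 0" "ebox I y d \<subseteq> D" "\<And>u. u \<in> ebox I y d \<Longrightarrow> \<bar>g u - g y\<bar> \<le> e"
proof -
  let ?W = "{u \<in> topspace (subtopology (powertop_real I) D). g u \<in> ball (g y) e}"
  have "openin (subtopology (powertop_real I) D) ?W"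
    by (rule openin_continuous_map_preimage[OF assms(1)]) auto
  then have "openin (powertop_real I) ?W"
    using assms(2) openin_trans_full by blast
  moreover have "y \<in> ?W"
    using assms(2,4,5) openin_subset by fastforce
  ultimately obtain d where "d > 0" "ebox I y d \<subseteq> ?W"
    using openin_powertop_ebox assms(3) by blast
  then show ?thesis
    by (intro that[of d]) (auto simp: subset_iff dist_real_def abs_minus_commute less_imp_le)
qed

text \<open>Continuity of the partial derivatives at \<open>y\<close> makes the linearisation error
  uniform over pairs of points near \<open>y\<close>: bound the error along one coordinate by the
  mean value inequality, then telescope over the coordinates. Having both points free yields the
  Lipschitz bound as well as the chain rule.\<close>

lemma cont_diff_strict_derivative:
  assumes cd: "cont_diff (Suc k) I D \<phi>" and D: "openin (powertop_real I) D"
    and fin: "finite I" and y: "y \<in> D" and e: "e > 0"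
  obtains d where "d > 0" "ebox I y d \<subseteq> D"
    "\<And>u u'. u \<in> ebox I y d \<Longrightarrow> u' \<in> ebox I y d \<Longrightarrow>
       \<bar>\<phi> u - \<phi> u' - (\<Sum>i\<in>I. partial i \<phi> y * (u i - u' i))\<bar> \<le> e * (\<Sum>i\<in>I. \<bar>u i - u' i\<bar>)"
proof -
  have cp: "continuous_map (subtopology (powertop_real I) D) euclideanreal (partial i \<phi>)"
    if "i \<in> I" for i
  proof -
    have "cont_diff k I D (partial i \<phi>)" using cd that by simp
    then show ?thesis by (cases k) auto
  qed
  have "\<exists>d>0. (\<forall>u\<in>ebox I y d. \<bar>partial i \<phi> u - partial i \<phi> y\<bar> \<le> e)"
    if "i \<in> I" for i
    using continuous_map_ebox[OF cp[OF that] D fin y e] by metis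
  then obtain dd where dd: "\<And>i. i \<in> I \<Longrightarrow> dd i > 0"
    "\<And>i u. i \<in> I \<Longrightarrow> u \<in> ebox I y (dd i) \<Longrightarrow> \<bar>partial i \<phi> u - partial i \<phi> y\<bar> \<le> e"
    by metis
  obtain d0 where d0: "d0 > 0" "ebox I y d0 \<subseteq> D"
    using openin_powertop_ebox[OF D fin y] .
  define d where "d = Min (insert d0 (dd ` I))"
  have d: "d > 0" "d \<le> d0" using fin dd(1) d0 by (auto simp: d_def)
  have dD: "ebox I y d \<subseteq> D" using ebox_mono d(2) d0(2) by blast
  have pd: "\<bar>partial i \<phi> u - partial i \<phi> y\<bar> \<le> e" if "i \<in> I" "u \<in> ebox I y d" for i u
  proof -
    have "d \<le> dd i" using fin that(1) by (auto simp: d_def)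
    then show ?thesis using ebox_mono that dd(2) by blast
  qed
  have coord: "\<bar>\<phi> u - \<phi> (u(i := s)) - partial i \<phi> y * (u i - s)\<bar> \<le> e * \<bar>u i - s\<bar>"
    if i: "i \<in> I" and u: "u \<in> ebox I y d" and s: "\<bar>s - y i\<bar> < d" for i u s
  proof -
    \<comment> \<open>With the linear term subtracted, the derivative is the variation of the
      partial derivative from its value at \<open>y\<close>, hence at most \<open>e\<close> in size
      on the box.\<close>
    let ?f = "\<lambda>r. \<phi> (u(i := r)) - partial i \<phi> y * r"
    let ?B = "ball (y i) d"
    have ud: "u(i := r) \<in> ebox I y d" if "r \<in> ?B" for r
      using ebox_update[OF u i] that by (simp add: dist_real_def abs_minus_commute)
    have der: "(?f has_field_derivative (partial i \<phi> (u(i := r)) - partial i \<phi> y)) (at r within ?B)"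
      if "r \<in> ?B" for r
    proof -
      have "\<forall>z\<in>D. (\<lambda>s. \<phi> (z(i := s))) differentiable at (z i)"
        using cd i by simp
      then have "(\<lambda>s. \<phi> ((u(i := r))(i := s))) differentiable at ((u(i := r)) i)"
        using ud[OF that] dD by blast
      then have "((\<lambda>s. \<phi> ((u(i := r))(i := s))) has_real_derivative partial i \<phi> (u(i := r)))
          (at ((u(i := r)) i))"
        unfolding partial_def by (simp only: DERIV_deriv_iff_real_differentiable)
      then have "((\<lambda>s. \<phi> (u(i := s))) has_real_derivative partial i \<phi> (u(i := r))) (at r)"
        by simp
      then show ?thesis
        by (auto intro!: derivative_eq_intros intro: has_field_derivative_at_within)
    qed
    have "norm (?f (u i) - ?f s) \<le> e * norm (u i - s)"
    proof (rule field_differentiable_bound[OF convex_ball der])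
      show "norm (partial i \<phi> (u(i := r)) - partial i \<phi> y) \<le> e" if "r \<in> ?B" for r
        using pd[OF i ud[OF that]] by simp
      show "u i \<in> ?B" using u i by (auto simp: ebox_def dist_real_def abs_minus_commute)
      show "s \<in> ?B" using s by (simp add: dist_real_def abs_minus_commute)
    qed
    then show ?thesis by (simp add: algebra_simps)
  qed
  \<comment> \<open>Change the coordinates one at a time.\<close>
  have tele: "\<bar>\<phi> u - \<phi> u' - (\<Sum>i\<in>S. partial i \<phi> y * (u i - u' i))\<bar> \<le> e * (\<Sum>i\<in>S. \<bar>u i - u' i\<bar>)"
    if "finite S" "S \<subseteq> I" "u \<in> ebox I y d" "u' \<in> ebox I y d" "\<And>j. j \<notin> S \<Longrightarrow> u j = u' j" for S u u'
    using that
  proof (induction S arbitrary: u rule: finite_induct)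
    case empty
    then have "u = u'" by auto
    then show ?case by simp
  next
    case (insert i S)
    let ?w = "u(i := u' i)"
    have i: "i \<in> I" and s: "\<bar>u' i - y i\<bar> < d" using insert.prems by (auto simp: ebox_def)
    have w: "?w \<in> ebox I y d" using ebox_update[OF insert.prems(2) i s] .
    have eq: "(\<Sum>k\<in>S. g k (?w k)) = (\<Sum>k\<in>S. g k (u k))" for g :: "nat \<Rightarrow> real \<Rightarrow> real"
      using insert.hyps by (intro sum.cong) auto
    have 1: "\<bar>\<phi> ?w - \<phi> u' - (\<Sum>k\<in>S. partial k \<phi> y * (?w k - u' k))\<bar> \<le> e * (\<Sum>k\<in>S. \<bar>?w k - u' k\<bar>)"
      using insert.prems by (intro insert.IH w) auto
    have 1: "\<bar>\<phi> ?w - \<phi> u' - (\<Sum>k\<in>S. partial k \<phi> y * (u k - u' k))\<bar> \<le> e * (\<Sum>k\<in>S. \<bar>u k - u' k\<bar>)"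
      using 1 eq[of "\<lambda>k a. partial k \<phi> y * (a - u' k)"] eq[of "\<lambda>k a. \<bar>a - u' k\<bar>"] by simp
    have 2: "\<bar>\<phi> u - \<phi> ?w - partial i \<phi> y * (u i - u' i)\<bar> \<le> e * \<bar>u i - u' i\<bar>"
      by (rule coord[OF i insert.prems(2) s])
    show ?case
      using 1 2 insert.hyps by (simp add: algebra_simps)
  qed
  show ?thesis
  proof (rule that[OF d(1) dD])
    fix u u' assume u: "u \<in> ebox I y d" "u' \<in> ebox I y d"
    show "\<bar>\<phi> u - \<phi> u' - (\<Sum>i\<in>I. partial i \<phi> y * (u i - u' i))\<bar> \<le> e * (\<Sum>i\<in>I. \<bar>u i - u' i\<bar>)"
      using u by (intro tele fin) (auto simp: ebox_def extensional_def)
  qed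
qed

text \<open>Take error 1 in the strict derivative; the linear part contributes at most the sum of
  the absolute partial derivatives at \<open>y\<close>.\<close>

lemma cont_diff_locally_Lipschitz:
  assumes "cont_diff (Suc k) I D \<phi>" "openin (powertop_real I) D" "finite I" "y \<in> D"
  obtains d L where "d > 0" "L \<ge> 0"
    "\<And>u u'. u \<in> ebox I y d \<Longrightarrow> u' \<in> ebox I y d \<Longrightarrow> \<bar>\<phi> u - \<phi> u'\<bar> \<le> L * (\<Sum>i\<in>I. \<bar>u i - u' i\<bar>)"
proof -
  obtain d where d: "d > 0" and sd: "\<And>u u'. u \<in> ebox I y d \<Longrightarrow> u' \<in> ebox I y d \<Longrightarrow>
       \<bar>\<phi> u - \<phi> u' - (\<Sum>i\<in>I. partial i \<phi> y * (u i - u' i))\<bar> \<le> 1 * (\<Sum>i\<in>I. \<bar>u i - u' i\<bar>)"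
    by (rule cont_diff_strict_derivative[OF assms, of 1]) (auto intro: that)
  define L where "L = 1 + (\<Sum>i\<in>I. \<bar>partial i \<phi> y\<bar>)"
  have "L \<ge> 0" by (simp add: L_def add_nonneg_nonneg sum_nonneg)
  moreover have "\<bar>\<phi> u - \<phi> u'\<bar> \<le> L * (\<Sum>i\<in>I. \<bar>u i - u' i\<bar>)"
    if "u \<in> ebox I y d" "u' \<in> ebox I y d" for u u'
  proof -
    have "\<bar>\<Sum>i\<in>I. partial i \<phi> y * (u i - u' i)\<bar> \<le> (\<Sum>i\<in>I. \<bar>partial i \<phi> y\<bar> * \<bar>u i - u' i\<bar>)"
      by (rule order_trans[OF sum_abs]) (simp add: abs_mult)
    also have "\<dots> \<le> (\<Sum>i\<in>I. (\<Sum>i\<in>I. \<bar>partial i \<phi> y\<bar>) * \<bar>u i - u' i\<bar>)"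
      using assms(3) by (intro sum_mono mult_right_mono member_le_sum) auto
    finally show ?thesis using sd[OF that] by (simp add: L_def sum_distrib_left algebra_simps)
  qed
  ultimately show ?thesis using d that by blast
qed

text \<open>After subtraction of the linear part in the \<open>Y i\<close>, the composite has
  derivative 0: the strict estimate bounds its increment by a small multiple of the increments of
  the \<open>Y i\<close>, which are O(\<open>s - t\<close>).\<close>

lemma cont_diff_chain_rule:
  assumes cd: "cont_diff (Suc k) I D \<phi>" and D: "openin (powertop_real I) D" and fin: "finite I"
    and y: "\<And>i. i \<in> I \<Longrightarrow> (Y i has_real_derivative Y' i) (at t)"
    and yD: "restrict (\<lambda>i. Y i t) I \<in> D"
  shows "((\<lambda>s. \<phi> (restrict (\<lambda>i. Y i s) I)) has_real_derivative
           (\<Sum>i\<in>I. partial i \<phi> (restrict (\<lambda>i. Y i t) I) * Y' i)) (at t)"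
proof -
  let ?y = "\<lambda>s. restrict (\<lambda>i. Y i s) I"
  let ?p = "\<lambda>i. partial i \<phi> (?y t)"
  let ?g = "\<lambda>s. \<phi> (?y s) - (\<Sum>i\<in>I. ?p i * Y i s)"
  \<comment> \<open>The summand 1 makes \<open>M\<close> positive even for empty
    \<open>I\<close>.\<close>
  define M where "M = 1 + (\<Sum>i\<in>I. \<bar>Y' i\<bar> + 1)"
  have M: "M > 0" unfolding M_def by (intro add_pos_nonneg sum_nonneg) auto
  have lip: "\<forall>\<^sub>F s in at t. \<bar>Y i s - Y i t\<bar> \<le> (\<bar>Y' i\<bar> + 1) * \<bar>s - t\<bar>" if "i \<in> I" for i
  proof -
    have "((\<lambda>s. (Y i s - Y i t) / (s - t)) \<longlongrightarrow> Y' i) (at t)"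
      using y[OF that] by (simp add: has_field_derivative_iff)
    then have "\<forall>\<^sub>F s in at t. dist ((Y i s - Y i t) / (s - t)) (Y' i) < 1"
      by (rule tendstoD) simp
    moreover have "\<forall>\<^sub>F s in at t. s \<noteq> t" by (simp add: eventually_at_filter)
    ultimately show ?thesis
    proof eventually_elim
      case (elim s)
      then have "\<bar>(Y i s - Y i t) / (s - t)\<bar> \<le> \<bar>Y' i\<bar> + 1" unfolding dist_real_def by linarith
      moreover have "\<bar>s - t\<bar> > 0" using elim(2) by simp
      ultimately show ?case by (simp only: abs_divide pos_divide_le_eq)
    qed
  qed
  have "(?g has_real_derivative 0) (at t)"
    unfolding has_field_derivative_iff
  proof (rule tendstoI)
    fix e :: real assume e: "e > 0"
    \<comment> \<open>The factor 2 leaves room for the strict inequality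
      \<open>e' * M < e\<close>.\<close>
    define e' where "e' = e / (2 * M)"
    have e': "e' > 0" "e' * M < e" using e M by (auto simp: e'_def)
    obtain d where d: "d > 0" and sd: "\<And>u u'. u \<in> ebox I (?y t) d \<Longrightarrow> u' \<in> ebox I (?y t) d \<Longrightarrow>
       \<bar>\<phi> u - \<phi> u' - (\<Sum>i\<in>I. ?p i * (u i - u' i))\<bar> \<le> e' * (\<Sum>i\<in>I. \<bar>u i - u' i\<bar>)"
      by (rule cont_diff_strict_derivative[OF cd D fin yD e'(1)]) (rule that)
    have cl: "\<forall>\<^sub>F s in at t. \<bar>Y i s - Y i t\<bar> < d" if "i \<in> I" for i
    proof -
      have "(Y i \<longlongrightarrow> Y i t) (at t)" using y[OF that] DERIV_isCont isCont_def by blast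
      then have "\<forall>\<^sub>F s in at t. dist (Y i s) (Y i t) < d" using d by (rule tendstoD)
      then show ?thesis by (simp add: dist_real_def)
    qed
    have quot: "dist (a / b) 0 < e" if "\<bar>a\<bar> < e * \<bar>b\<bar>" "b \<noteq> 0" for a b :: real
      using that by (simp add: abs_divide pos_divide_less_eq)
    have "\<forall>\<^sub>F s in at t. \<forall>i\<in>I. \<bar>Y i s - Y i t\<bar> \<le> (\<bar>Y' i\<bar> + 1) * \<bar>s - t\<bar>"
      using fin lip by (simp add: eventually_ball_finite)
    moreover have "\<forall>\<^sub>F s in at t. \<forall>i\<in>I. \<bar>Y i s - Y i t\<bar> < d"
      using fin cl by (simp add: eventually_ball_finite)
    moreover have "\<forall>\<^sub>F s in at t. s \<noteq> t" by (simp add: eventually_at_filter)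
    ultimately show "\<forall>\<^sub>F s in at t. dist ((?g s - ?g t) / (s - t)) 0 < e"
    proof eventually_elim
      case (elim s)
      have "?y s \<in> ebox I (?y t) d" "?y t \<in> ebox I (?y t) d"
        using elim(2) d by (auto simp: ebox_def)
      note sd = sd[OF this]
      have eq: "\<phi> (?y s) - \<phi> (?y t) - (\<Sum>i\<in>I. ?p i * (?y s i - ?y t i)) = ?g s - ?g t"
        by (simp add: right_diff_distrib sum_subtractf)
      have "(\<Sum>i\<in>I. \<bar>?y s i - ?y t i\<bar>) \<le> (\<Sum>i\<in>I. (\<bar>Y' i\<bar> + 1) * \<bar>s - t\<bar>)"
        using elim(1) by (intro sum_mono) simp
      also have "\<dots> = (\<Sum>i\<in>I. \<bar>Y' i\<bar> + 1) * \<bar>s - t\<bar>"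
        by (rule sum_distrib_right[symmetric])
      also have "\<dots> \<le> M * \<bar>s - t\<bar>"
        unfolding M_def by (rule mult_right_mono) simp_all
      finally have le: "(\<Sum>i\<in>I. \<bar>?y s i - ?y t i\<bar>) \<le> M * \<bar>s - t\<bar>" .
      have "\<bar>?g s - ?g t\<bar> \<le> e' * (\<Sum>i\<in>I. \<bar>?y s i - ?y t i\<bar>)"
        using sd unfolding eq .
      also have "\<dots> \<le> e' * (M * \<bar>s - t\<bar>)"
        by (rule mult_left_mono[OF le less_imp_le[OF e'(1)]])
      also have "\<dots> = (e' * M) * \<bar>s - t\<bar>"
        by (rule mult.assoc[symmetric])
      also have "\<dots> < e * \<bar>s - t\<bar>"
        using elim(3) by (intro mult_strict_right_mono e'(2)) simp
      finally show ?case by (rule quot) (use elim(3) in simp)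
    qed
  qed
  moreover have "((\<lambda>s. \<Sum>i\<in>I. ?p i * Y i s) has_real_derivative (\<Sum>i\<in>I. ?p i * Y' i)) (at t)"
    by (intro DERIV_sum DERIV_cmult y)
  ultimately have "((\<lambda>s. ?g s + (\<Sum>i\<in>I. ?p i * Y i s)) has_real_derivative
      (0 + (\<Sum>i\<in>I. ?p i * Y' i))) (at t)"
    by (rule DERIV_add)
  then show ?thesis by simp
qed

section \<open>Local solvability of autonomous Lipschitz systems in integral form\<close>

section \<open>Picard iteration\<close>

text \<open>On a short interval to the right of \<open>a\<close> the Picard operator preserves the
  closed box around \<open>x0\<close> and halves sup-distances, so its iterates converge uniformly
  to a fixed point.\<close>

lemma picard_existence:
  fixes F :: "nat \<Rightarrow> (nat \<Rightarrow> real) \<Rightarrow> real" and a :: real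
  assumes fin: "finite A" and e: "e > 0" and L: "L \<ge> 0"
    and lip: "\<And>i y y'. i \<in> A \<Longrightarrow> \<forall>k\<in>A. \<bar>y k - x0 k\<bar> \<le> e \<Longrightarrow> \<forall>k\<in>A. \<bar>y' k - x0 k\<bar> \<le> e \<Longrightarrow>
        \<bar>F i y - F i y'\<bar> \<le> L * (\<Sum>k\<in>A. \<bar>y k - y' k\<bar>)"
  obtains d X where "d > 0"
    "\<And>i t. i \<in> A \<Longrightarrow> t \<in> {a..a+d} \<Longrightarrow> \<bar>X i t - x0 i\<bar> \<le> e"
    "\<And>i. i \<in> A \<Longrightarrow> continuous_on {a..a+d} (\<lambda>s. F i (\<lambda>k. X k s))"
    "\<And>i t. i \<in> A \<Longrightarrow> t \<in> {a..a+d} \<Longrightarrow> X i t = x0 i + integral {a..t} (\<lambda>s. F i (\<lambda>k. X k s))"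
proof -
  \<comment> \<open>\<open>K\<close> is the Lipschitz constant for the max norm in place of the sum
    norm, and \<open>M\<close> bounds every \<open>F i\<close> on the box.\<close>
  define K where "K = L * card A"
  define M where "M = (\<Sum>i\<in>A. \<bar>F i x0\<bar>) + K * e"
  have K: "K \<ge> 0" and M: "M \<ge> 0" using L e by (auto simp: K_def M_def sum_nonneg)
  \<comment> \<open>The first bound gives \<open>M * d \<le> e\<close>, so curves stay in the box;
    the second gives \<open>K * d \<le> 1 / 2\<close>, the contraction factor.\<close>
  define d where "d = min (e / (M + 1)) (1 / (2 * (K + 1)))"
  have d: "d > 0" using e K M by (auto simp: d_def)
  have Md: "M * d \<le> e"
  proof -
    have "M * d \<le> M * (e / (M + 1))" using M by (intro mult_left_mono) (auto simp: d_def)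
    also have "\<dots> \<le> e" using M e by (simp add: field_simps)
    finally show ?thesis .
  qed
  have Kd: "K * d \<le> 1 / 2"
  proof -
    have "K * d \<le> K * (1 / (2 * (K + 1)))" using K by (intro mult_left_mono) (auto simp: d_def)
    also have "\<dots> \<le> 1 / 2" using K by (simp add: field_simps)
    finally show ?thesis .
  qed
  define J where "J = {a..a+d}"
  define T where "T = (\<lambda>Q i t. x0 i + integral {a..t} (\<lambda>s. F i (\<lambda>k. Q k s)))"
  define good where "good = (\<lambda>X. \<forall>i\<in>A. continuous_on J (X i) \<and> (\<forall>t\<in>J. \<bar>X i t - x0 i\<bar> \<le> e))"
  have lipK: "\<bar>F i y - F i y'\<bar> \<le> K * r"
    if "i \<in> A" "\<forall>k\<in>A. \<bar>y k - x0 k\<bar> \<le> e" "\<forall>k\<in>A. \<bar>y' k - x0 k\<bar> \<le> e" "\<forall>k\<in>A. \<bar>y k - y' k\<bar> \<le> r"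
    for i y y' r
  proof -
    have "(\<Sum>k\<in>A. \<bar>y k - y' k\<bar>) \<le> card A * r" using that(4) by (intro sum_bounded_above) auto
    then have "L * (\<Sum>k\<in>A. \<bar>y k - y' k\<bar>) \<le> K * r"
      using L by (simp add: K_def mult.assoc mult_left_mono)
    then show ?thesis using lip[OF that(1-3)] by linarith
  qed
  have FM: "\<bar>F i y\<bar> \<le> M" if i: "i \<in> A" and y: "\<forall>k\<in>A. \<bar>y k - x0 k\<bar> \<le> e" for i y
  proof -
    have "\<bar>F i y - F i x0\<bar> \<le> K * e" using y e by (intro lipK[OF i]) auto
    moreover have "\<bar>F i x0\<bar> \<le> (\<Sum>i\<in>A. \<bar>F i x0\<bar>)" using fin i by (intro member_le_sum) auto
    ultimately show ?thesis by (simp add: M_def)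
  qed
  have cF: "continuous_on J (\<lambda>s. F i (\<lambda>k. X k s))" if X: "good X" and i: "i \<in> A" for X i
    unfolding continuous_on_def
  proof
    fix s assume s: "s \<in> J"
    have "(X k \<longlongrightarrow> X k s) (at s within J)" if "k \<in> A" for k
      using X s that by (simp add: good_def continuous_on_def)
    then have "((\<lambda>r. L * (\<Sum>k\<in>A. \<bar>X k r - X k s\<bar>)) \<longlongrightarrow> L * (\<Sum>k\<in>A. \<bar>X k s - X k s\<bar>)) (at s within J)"
      by (intro tendsto_intros)
    then have to0: "((\<lambda>r. L * (\<Sum>k\<in>A. \<bar>X k r - X k s\<bar>)) \<longlongrightarrow> 0) (at s within J)"
      by (simp only: diff_self abs_zero sum.neutral_const mult_zero_right)
    have le: "\<forall>\<^sub>F r in at s within J.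
        norm (F i (\<lambda>k. X k r) - F i (\<lambda>k. X k s)) \<le> L * (\<Sum>k\<in>A. \<bar>X k r - X k s\<bar>)"
      unfolding eventually_at_filter
    proof (intro always_eventually allI impI)
      fix r assume "r \<in> J"
      then have "\<bar>F i (\<lambda>k. X k r) - F i (\<lambda>k. X k s)\<bar> \<le> L * (\<Sum>k\<in>A. \<bar>X k r - X k s\<bar>)"
        using X s by (intro lip[OF i]) (auto simp: good_def)
      then show "norm (F i (\<lambda>k. X k r) - F i (\<lambda>k. X k s)) \<le> L * (\<Sum>k\<in>A. \<bar>X k r - X k s\<bar>)"
        by simp
    qed
    show "((\<lambda>r. F i (\<lambda>k. X k r)) \<longlongrightarrow> F i (\<lambda>k. X k s)) (at s within J)"
      by (rule LIM_zero_cancel[OF Lim_null_comparison[OF le to0]])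
  qed
  have cFt: "continuous_on {a..t} (\<lambda>s. F i (\<lambda>k. X k s))" if "good X" "i \<in> A" "t \<in> J" for X i t
    using cF[OF that(1,2)] that(3) by (auto simp: J_def intro: continuous_on_subset)
  have good_T: "good (T X)" if X: "good X" for X
    unfolding good_def
  proof (intro ballI conjI)
    fix i assume i: "i \<in> A"
    show "continuous_on J (T X i)"
      using cF[OF X i] unfolding T_def J_def
      by (intro continuous_intros indefinite_integral_continuous_1 integrable_continuous_real)
    fix t assume t: "t \<in> J"
    have "norm (integral {a..t} (\<lambda>s. F i (\<lambda>k. X k s))) \<le> M * (t - a)"
    proof (intro integral_bound cFt[OF X i t])
      fix s assume "s \<in> {a..t}"
      then have "s \<in> J" using t by (simp add: J_def)
      then show "norm (F i (\<lambda>k. X k s)) \<le> M" using X FM[OF i] by (simp add: good_def)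
    qed (use t in \<open>simp add: J_def\<close>)
    also have "\<dots> \<le> M * d" using t M by (intro mult_left_mono) (auto simp: J_def)
    finally show "\<bar>T X i t - x0 i\<bar> \<le> e" using Md by (simp add: T_def)
  qed
  have contr: "\<bar>T X i t - T Y i t\<bar> \<le> r / 2"
    if X: "good X" and Y: "good Y" and i: "i \<in> A" and t: "t \<in> J"
      and r: "\<And>k t. k \<in> A \<Longrightarrow> t \<in> J \<Longrightarrow> \<bar>X k t - Y k t\<bar> \<le> r" for X Y i t r
  proof -
    have r0: "r \<ge> 0" using r[OF i t] by linarith
    have "T X i t - T Y i t = integral {a..t} (\<lambda>s. F i (\<lambda>k. X k s) - F i (\<lambda>k. Y k s))"
      by (simp add: T_def integral_diff integrable_continuous_real cFt X Y i t)
    also have "norm \<dots> \<le> K * r * (t - a)"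
    proof (intro integral_bound continuous_on_diff cFt X Y i t)
      fix s assume "s \<in> {a..t}"
      then have "s \<in> J" using t by (simp add: J_def)
      then show "norm (F i (\<lambda>k. X k s) - F i (\<lambda>k. Y k s)) \<le> K * r"
        using X Y r lipK[OF i] by (simp add: good_def)
    qed (use t in \<open>simp add: J_def\<close>)
    also have "\<dots> \<le> K * r * d" using t K r0 by (intro mult_left_mono) (auto simp: J_def)
    also have "\<dots> = (K * d) * r" by simp
    also have "\<dots> \<le> 1 / 2 * r" using Kd r0 by (rule mult_right_mono)
    finally show ?thesis by simp
  qed
  define P where "P = rec_nat (\<lambda>i t. x0 i) (\<lambda>_. T)"
  have P0: "P 0 = (\<lambda>i t. x0 i)" and PS: "P (Suc m) = T (P m)" for m by (simp_all add: P_def)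
  have gP: "good (P m)" for m
  proof (induction m)
    case 0
    then show ?case using e by (simp add: P0 good_def)
  qed (simp add: PS good_T)
  have step: "\<bar>P (Suc m) i t - P m i t\<bar> \<le> e * (1/2)^m" if "i \<in> A" "t \<in> J" for m i t
    using that
  proof (induction m arbitrary: i t)
    case 0
    then show ?case using gP[of 1] by (auto simp: P0 good_def)
  next
    case (Suc m)
    have "\<bar>T (P (Suc m)) i t - T (P m) i t\<bar> \<le> e * (1/2)^m / 2"
      using Suc by (intro contr gP) auto
    then show ?case by (simp add: PS)
  qed
  \<comment> \<open>The limit is a telescoping series dominated by a geometric one, so the
    Weierstrass test gives uniform convergence.\<close>
  define X where "X = (\<lambda>i t. x0 i + (\<Sum>m. P (Suc m) i t - P m i t))"
  have ul: "uniform_limit J (\<lambda>m. P m i) (X i) sequentially" if i: "i \<in> A" for i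
  proof -
    have "uniform_limit J (\<lambda>n t. \<Sum>m<n. P (Suc m) i t - P m i t)
        (\<lambda>t. \<Sum>m. P (Suc m) i t - P m i t) sequentially"
      using step[OF i] by (intro Weierstrass_m_test[where M = "\<lambda>m. e * (1/2)^m"])
        (auto intro!: summable_mult summable_geometric)
    moreover have "(\<lambda>n. P n i) = (\<lambda>n t. x0 i + (\<Sum>m<n. P (Suc m) i t - P m i t))"
    proof (intro ext)
      show "P n i t = x0 i + (\<Sum>m<n. P (Suc m) i t - P m i t)" for n t
        using sum_lessThan_telescope[of "\<lambda>m. P m i t" n] by (simp add: P0)
    qed
    ultimately show ?thesis
      unfolding X_def by (simp only: uniform_limit_iff dist_real_def add_diff_cancel_left)
  qed
  have gX: "good X"
    unfolding good_def
  proof (intro ballI conjI)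
    fix i assume i: "i \<in> A"
    show "continuous_on J (X i)"
      by (rule uniform_limit_theorem[OF _ ul[OF i]]) (use gP i in \<open>auto simp: good_def\<close>)
    fix t assume t: "t \<in> J"
    have "(\<lambda>m. \<bar>P m i t - x0 i\<bar>) \<longlonglongrightarrow> \<bar>X i t - x0 i\<bar>"
      by (intro tendsto_intros tendsto_uniform_limitI[OF ul[OF i] t])
    then show "\<bar>X i t - x0 i\<bar> \<le> e"
      by (rule tendsto_upperbound) (use gP i t in \<open>auto simp: good_def\<close>)
  qed
  have fixp: "X i t = T X i t" if i: "i \<in> A" and t: "t \<in> J" for i t
  proof -
    \<comment> \<open>For large \<open>m\<close>, \<open>T (P m)\<close> is the next iterate, hence
      close to \<open>X\<close>, and by contraction it is close to \<open>T X\<close>.\<close>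
    have "\<bar>X i t - T X i t\<bar> \<le> 0 + r" if r: "r > 0" for r
    proof -
      have "\<forall>\<^sub>F m in sequentially. \<forall>t\<in>J. dist (P m k t) (X k t) < r / 2" if "k \<in> A" for k
        by (rule uniform_limitD[OF ul[OF that]]) (use r in simp)
      then have "\<forall>\<^sub>F m in sequentially. \<forall>k\<in>A. \<forall>t\<in>J. dist (P m k t) (X k t) < r / 2"
        using fin by (simp add: eventually_ball_finite)
      then obtain m where m: "\<And>m' k t. m' \<ge> m \<Longrightarrow> k \<in> A \<Longrightarrow> t \<in> J \<Longrightarrow> \<bar>P m' k t - X k t\<bar> < r / 2"
        unfolding eventually_sequentially dist_real_def by blast
      have "\<bar>T (P m) i t - T X i t\<bar> \<le> (r / 2) / 2"
        using m[of m] by (intro contr gP gX i t) (auto simp: less_imp_le)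
      moreover have "\<bar>T (P m) i t - X i t\<bar> < r / 2" using m[of "Suc m"] i t by (simp add: PS)
      ultimately show ?thesis using r by linarith
    qed
    then have "\<bar>X i t - T X i t\<bar> \<le> 0" by (rule field_le_epsilon)
    then show ?thesis by simp
  qed
  show ?thesis
  proof (rule that[OF d, of X])
    show "\<bar>X i t - x0 i\<bar> \<le> e" if "i \<in> A" "t \<in> {a..a+d}" for i t
      using gX that by (simp add: good_def J_def)
    show "continuous_on {a..a+d} (\<lambda>s. F i (\<lambda>k. X k s))" if "i \<in> A" for i
      using cF[OF gX that] by (simp add: J_def)
    show "X i t = x0 i + integral {a..t} (\<lambda>s. F i (\<lambda>k. X k s))" if "i \<in> A" "t \<in> {a..a+d}" for i t
      using fixp[OF that(1)] that(2) by (simp add: J_def T_def)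
  qed
qed

section \<open>Closure of k-fold differentiability under sums, products and composition\<close>

section \<open>Repeatedly differentiable curves\<close>

text \<open>Continuity of the last derivative is not demanded. Holding for every \<open>k\<close>,
  this is the differentiability clause of \<open>dae_solution\<close>.\<close>

definition times_diff :: "nat \<Rightarrow> real set \<Rightarrow> (real \<Rightarrow> real) \<Rightarrow> bool" where
  "times_diff k S x \<longleftrightarrow> (\<forall>m<k. \<forall>t\<in>S. (deriv ^^ m) x differentiable at t)"

lemma times_diff_0 [simp]: "times_diff 0 S x"
  by (simp add: times_diff_def)

lemma times_diff_Suc:
  "times_diff (Suc k) S x \<longleftrightarrow> (\<forall>t\<in>S. x differentiable at t) \<and> times_diff k S (deriv x)"
  by (simp add: times_diff_def All_less_Suc2 funpow_Suc_right del: funpow.simps(2))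

lemma times_diff_mono: "times_diff k S x \<Longrightarrow> k' \<le> k \<Longrightarrow> times_diff k' S x"
  by (simp add: times_diff_def)

text \<open>On an open set, agreement on \<open>S\<close> is agreement near each point of
  \<open>S\<close>, so it passes to the derivatives and the induction continues with those.\<close>

lemma times_diff_cong:
  assumes "open S" "\<And>t. t \<in> S \<Longrightarrow> x t = y t" "times_diff k S x"
  shows "times_diff k S y"
  using assms(2,3)
proof (induction k arbitrary: x y)
  case (Suc k)
  have ev: "\<forall>\<^sub>F s in nhds t. x s = y s" if "t \<in> S" for t
    using assms(1) Suc.prems(1) that eventually_nhds by blast
  have "y differentiable at t" if "t \<in> S" for t
  proof -
    have "(x has_real_derivative deriv x t) (at t)"
      using Suc.prems(2) that by (auto simp: times_diff_Suc DERIV_deriv_iff_real_differentiable)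
    then have "(y has_real_derivative deriv x t) (at t)"
      using DERIV_cong_ev[OF refl ev[OF that] refl] by simp
    then show ?thesis by (simp add: real_differentiable_def) blast
  qed
  moreover have "deriv x t = deriv y t" if "t \<in> S" for t
    by (rule deriv_cong_ev[OF ev[OF that] refl])
  ultimately show ?case using Suc by (auto simp: times_diff_Suc)
qed simp

lemma times_diff_SucI:
  assumes "open S" "\<And>t. t \<in> S \<Longrightarrow> (x has_real_derivative x' t) (at t)" "times_diff k S x'"
  shows "times_diff (Suc k) S x"
  unfolding times_diff_Suc
proof
  show "\<forall>t\<in>S. x differentiable at t" using assms(2) real_differentiable_def by blast
  show "times_diff k S (deriv x)"
    by (rule times_diff_cong[OF assms(1) _ assms(3)]) (simp add: DERIV_imp_deriv[OF assms(2)])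
qed

lemma times_diff_Suc_derivative:
  assumes "times_diff (Suc k) S x" "t \<in> S"
  shows "(x has_real_derivative deriv x t) (at t)"
  using assms by (simp add: times_diff_Suc DERIV_deriv_iff_real_differentiable)

lemma times_diff_const: "open S \<Longrightarrow> times_diff k S (\<lambda>t. c)"
  by (induction k arbitrary: c) (auto intro!: times_diff_SucI[where x' = "\<lambda>t. 0"])

lemma times_diff_ident: "open S \<Longrightarrow> times_diff k S (\<lambda>t. t)"
  by (cases k) (auto intro!: times_diff_SucI[where x' = "\<lambda>t. 1"] times_diff_const)

lemma times_diff_add:
  assumes "open S" "times_diff k S x" "times_diff k S y"
  shows "times_diff k S (\<lambda>t. x t + y t)"
  using assms(2,3)
proof (induction k arbitrary: x y)
  case (Suc k)
  then show ?case
    by (intro times_diff_SucI[OF assms(1), where x' = "\<lambda>t. deriv x t + deriv y t"])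
      (auto intro!: DERIV_add times_diff_Suc_derivative simp: times_diff_Suc[of _ _ x] times_diff_Suc[of _ _ y])
qed simp

lemma times_diff_sum:
  assumes "open S" "\<And>i. i \<in> I \<Longrightarrow> times_diff k S (x i)"
  shows "times_diff k S (\<lambda>t. \<Sum>i\<in>I. x i t)"
  using assms(2)
  by (induction I rule: infinite_finite_induct) (auto intro: times_diff_const times_diff_add assms(1))

lemma times_diff_mult:
  assumes "open S" "times_diff k S x" "times_diff k S y"
  shows "times_diff k S (\<lambda>t. x t * y t)"
  using assms(2,3)
proof (induction k arbitrary: x y)
  case (Suc k)
  have "times_diff k S x" "times_diff k S y" using Suc.prems by (auto intro: times_diff_mono)
  moreover have "times_diff k S (deriv x)" "times_diff k S (deriv y)"
    using Suc.prems by (auto simp: times_diff_Suc)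
  ultimately have "times_diff k S (\<lambda>t. deriv x t * y t + deriv y t * x t)"
    by (intro times_diff_add assms(1) Suc.IH)
  then show ?case
    by (intro times_diff_SucI[OF assms(1), where x' = "\<lambda>t. deriv x t * y t + deriv y t * x t"])
      (auto intro!: DERIV_mult times_diff_Suc_derivative Suc.prems)
qed simp

text \<open>By the chain rule the derivative is a sum of products of \<open>partial i \<phi>\<close>
  along the curve with \<open>deriv (Y i)\<close>. The partial derivatives are of class one lower,
  so the induction must be general in \<open>\<phi>\<close>.\<close>

lemma times_diff_compose:
  assumes S: "open S" and D: "openin (powertop_real I) D" and fin: "finite I"
    and "\<And>t. t \<in> S \<Longrightarrow> restrict (\<lambda>i. Y i t) I \<in> D"
    and "cont_diff k I D \<phi>" and "\<And>i. i \<in> I \<Longrightarrow> times_diff k S (Y i)"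
  shows "times_diff k S (\<lambda>t. \<phi> (restrict (\<lambda>i. Y i t) I))"
  using assms(4-)
proof (induction k arbitrary: \<phi>)
  case (Suc k)
  have dY: "times_diff k S (Y i)" "times_diff k S (deriv (Y i))" if "i \<in> I" for i
    using Suc.prems(3)[OF that] times_diff_mono[of "Suc k" S "Y i" k] by (simp_all add: times_diff_Suc)
  have "times_diff k S (\<lambda>t. partial i \<phi> (restrict (\<lambda>i. Y i t) I))" if "i \<in> I" for i
    using Suc.prems that dY(1) by (intro Suc.IH) auto
  then have "times_diff k S
      (\<lambda>t. \<Sum>i\<in>I. partial i \<phi> (restrict (\<lambda>i. Y i t) I) * deriv (Y i) t)"
    using dY(2) by (intro times_diff_sum times_diff_mult S) auto
  then show ?case
    by (intro times_diff_SucI[OF S cont_diff_chain_rule[OF Suc.prems(2) D fin _ Suc.prems(1)]])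
      (auto intro: times_diff_Suc_derivative Suc.prems(3))
qed simp

section \<open>Signature matrix, offsets and Jacobian: claims (i) to (iii)\<close>

section \<open>The structure of the sub-ODE system\<close>

lemma set_deriv_snd: "snd (set_deriv p j k s) l m = (if l = j \<and> m = k then s else snd p l m)"
  by (simp add: set_deriv_def)

text \<open>The determinant of a triangular matrix is the product of its diagonal, here 1.\<close>

lemma invertible_unit_lower_triangular:
  fixes A :: "real mat"
  assumes "unit_lower_triangular A"
  shows "invertible_mat A"
proof -
  define m where "m = dim_row A"
  have A: "A \<in> carrier_mat m m"
    using assms by (auto simp: unit_lower_triangular_def m_def)
  have "det A = prod_list (diag_mat A)"
    by (rule det_lower_triangular[OF _ A]) (use assms A in \<open>auto simp: unit_lower_triangular_def\<close>)
  also have "diag_mat A = map (\<lambda>i. 1) [0..<m]"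
    using assms A by (auto simp: diag_mat_def unit_lower_triangular_def)
  also have "prod_list \<dots> = 1" by (simp add: map_replicate_const prod_list_replicate)
  finally have "det A \<noteq> 0" by simp
  from det_non_zero_imp_unit[OF A this]
  obtain B where "B \<in> carrier_mat m m" "A * B = 1\<^sub>m m" "B * A = 1\<^sub>m m"
    by (auto simp: Units_def ring_mat_def)
  then show ?thesis using A by (auto simp: invertible_mat_def inverts_mat_def)
qed

locale code_list_replacement =
  fixes C :: code_list and R :: replacement
  assumes code_list: "code_list C" and replacement: "sub_ode_replacement C R"
begin

abbreviation "n \<equiv> cl_n C"
abbreviation "N \<equiv> cl_N C"
abbreviation "H \<equiv> sub_ode_dae C R"

text \<open>As \<open>d\<close> is constantly 1, the bound for row \<open>i\<close> is
  \<open>1 - c i\<close> in every column; it is the order of the leading derivative of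
  \<open>x_i\<close> in that row.\<close>

definition c :: "nat \<Rightarrow> int" where
  "c = (\<lambda>i. if i \<in> ode_rows C \<union> sub_ode_rows R then 0 else 1)"

lemma c_le_1: "c i \<le> 1"
  by (simp add: c_def)

lemma n_pos: "1 \<le> n" and n_less_N: "n + 1 \<le> N"
  using code_list by (auto simp: code_list_def)

lemma args_bounds: "i \<in> cl_args C j \<Longrightarrow> 1 \<le> i \<and> i < j \<and> n + 2 \<le> j \<and> j \<le> N"
  using code_list by (auto simp: code_list_def cl_args_def)

lemma finite_args: "finite (cl_args C j)"
  by (rule finite_subset[of _ "{..j}"]) (use args_bounds in force)+

lemma smooth_fun: "j \<in> {n+2..N} \<Longrightarrow> smooth (cl_args C j) (cl_dom C j) (cl_fun C j)"
  using code_list by (auto simp: code_list_def)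

lemma out_bounds: "i \<in> {1..n} \<Longrightarrow> cl_out C i \<in> {1..N}"
  using code_list by (auto simp: code_list_def)

lemma block_of_eq: "J \<in> r_blocks R \<Longrightarrow> j \<in> J \<Longrightarrow> block_of R j = J"
  using replacement unfolding block_of_def sub_ode_replacement_def pairwise_def disjnt_def
  by (intro the_equality) blast+

lemma block_of:
  assumes "j \<in> sub_ode_rows R"
  shows "block_of R j \<in> r_blocks R" "j \<in> block_of R j"
  using assms block_of_eq by (auto simp: sub_ode_rows_def)

lemma block_subset: "J \<in> r_blocks R \<Longrightarrow> J \<subseteq> {n+2..N}"
  using replacement by (auto simp: sub_ode_replacement_def)

lemma block_args: "J \<in> r_blocks R \<Longrightarrow> j \<in> J \<Longrightarrow> cl_args C j = {r_arg R J}"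
  using replacement by (auto simp: sub_ode_replacement_def)

lemma block_graph:
  assumes "J \<in> r_blocks R" "\<forall>j\<in>J. scalar_arg R J u \<in> cl_dom C j"
  shows "block_graph C R J u \<in> r_dom R J"
    and "j \<in> J \<Longrightarrow> ((\<lambda>s. cl_fun C j (scalar_arg R J s)) has_real_derivative
            r_fun R j (block_graph C R J u)) (at u)"
  using assms replacement by (auto simp: sub_ode_replacement_def)

lemma r_arg_less: "J \<in> r_blocks R \<Longrightarrow> j \<in> J \<Longrightarrow> r_arg R J < j"
  using args_bounds block_args by blast

lemma sub_ode_rows_subset: "sub_ode_rows R \<subseteq> {n+2..N}"
  using block_subset by (auto simp: sub_ode_rows_def)

lemma size_H [simp]: "dae_size H = N"
  by (simp add: sub_ode_dae_def)

lemma eqn_H: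
  "i \<le> n \<Longrightarrow> dae_eqn H i p = snd p i 1 - snd p (cl_out C i) 0"
  "i = n + 1 \<Longrightarrow> dae_eqn H i p = snd p i 0 - fst p"
  "i \<in> {n+2..N} \<Longrightarrow> i \<notin> sub_ode_rows R \<Longrightarrow>
     dae_eqn H i p = snd p i 0 - cl_fun C i (restrict (\<lambda>j. snd p j 0) (cl_args C i))"
  "i \<in> sub_ode_rows R \<Longrightarrow> dae_eqn H i p =
     snd p i 1 - r_fun R i (block_vars R (block_of R i) (snd p)) * snd p (r_arg R (block_of R i)) 1"
  using sub_ode_rows_subset
  by (auto simp: sub_ode_dae_def code_list_dae_def split: prod.splits)

lemma dom_H:
  "i \<le> n + 1 \<Longrightarrow> p \<in> dae_dom H i"
  "i \<in> {n+2..N} \<Longrightarrow> i \<notin> sub_ode_rows R \<Longrightarrow>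
     p \<in> dae_dom H i \<longleftrightarrow> restrict (\<lambda>j. snd p j 0) (cl_args C i) \<in> cl_dom C i"
  "i \<in> sub_ode_rows R \<Longrightarrow>
     p \<in> dae_dom H i \<longleftrightarrow> block_vars R (block_of R i) (snd p) \<in> r_dom R (block_of R i)"
  using sub_ode_rows_subset
  by (auto simp: sub_ode_dae_def code_list_dae_def split: prod.splits)

lemma row_cases:
  assumes "i \<in> {1..N}"
  obtains (ode) "i \<in> {1..n}" "i \<notin> sub_ode_rows R" "c i = 0"
    | (time) "i = n + 1" "i \<notin> sub_ode_rows R" "c i = 1"
    | (sub) "i \<in> sub_ode_rows R" "i \<in> {n+2..N}" "c i = 0"
    | (ordinary) "i \<in> {n+2..N}" "i \<notin> sub_ode_rows R" "c i = 1"
  using assms sub_ode_rows_subset by (force simp: ode_rows_def c_def)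

lemma restrict_set_deriv:
  "k \<noteq> 0 \<or> j \<notin> I \<Longrightarrow>
     restrict (\<lambda>l. snd (set_deriv p j k s) l 0) I = restrict (\<lambda>l. snd p l 0) I"
  by (auto simp: restrict_def set_deriv_snd)

lemma block_vars_set_deriv:
  "k \<noteq> 0 \<Longrightarrow> block_vars R J (snd (set_deriv p j k s)) = block_vars R J (snd p)"
  by (simp add: block_vars_def restrict_set_deriv)

text \<open>In ODE and sub-ODE rows the bound is 1, and first derivatives occur only of
  \<open>x_i\<close> and of the block argument, which has smaller index; \<open>x_out(i)\<close> and
  the other block variables may have larger index but occur undifferentiated. In ordinary rows the
  bound is 0, and soundness makes the arguments precede \<open>i\<close>.\<close>

lemma occurs_H:
  assumes i: "i \<in> {1..N}" and occ: "occurs H i j k"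
  shows "int k \<le> 1 - c i" "int k = 1 - c i \<Longrightarrow> j \<le> i"
proof -
  obtain p s where ne: "dae_eqn H i (set_deriv p j k s) \<noteq> dae_eqn H i p"
    using occ by (auto simp: occurs_def)
  have "int k \<le> 1 - c i \<and> (int k = 1 - c i \<longrightarrow> j \<le> i)"
    using i
  proof (cases rule: row_cases)
    case ode
    then show ?thesis using ne by (auto simp: eqn_H set_deriv_snd split: if_splits)
  next
    case time
    then show ?thesis using ne
      by (auto simp: eqn_H set_deriv_snd set_deriv_def split: if_splits)
  next
    case sub
    then show ?thesis
      \<comment> \<open>For \<open>k = 0\<close> the order is below the bound. For
        \<open>k \<noteq> 0\<close> the block vector is unchanged, so only the two explicit first
        derivatives can matter.\<close>
      using ne r_arg_less[OF block_of] block_vars_set_deriv[of k _ p j s]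
      by (cases "k = 0") (auto simp: eqn_H(4) set_deriv_snd less_imp_le split: if_splits)
  next
    case ordinary
    have "k = 0 \<and> (j = i \<or> j \<in> cl_args C i)"
    proof (rule ccontr)
      assume "\<not> (k = 0 \<and> (j = i \<or> j \<in> cl_args C i))"
      then have "k \<noteq> 0 \<or> j \<notin> cl_args C i" "\<not> (i = j \<and> 0 = k)" by auto
      then show False
        using ne ordinary by (auto split: if_splits simp: eqn_H(3) restrict_set_deriv set_deriv_snd[of p j k s i 0])
    qed
    then show ?thesis using ordinary args_bounds[of j i] by auto
  qed
  then show "int k \<le> 1 - c i" "int k = 1 - c i \<Longrightarrow> j \<le> i" by auto
qed

text \<open>The leading derivative of \<open>x_i\<close> enters its own row once, with coefficient
  1, and is not among the arguments of the remaining term. This gives both the diagonal signature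
  and the unit diagonal of the Jacobian.\<close>

lemma eqn_H_diag:
  assumes i: "i \<in> {1..N}"
  shows "dae_eqn H i (set_deriv p i (nat (1 - c i)) s) =
      dae_eqn H i p + s - snd p i (nat (1 - c i))"
  using i
proof (cases rule: row_cases)
  case sub
  then show ?thesis using r_arg_less[OF block_of, of i]
    by (auto simp: eqn_H(4) set_deriv_snd block_vars_set_deriv)
next
  case ordinary
  then have "i \<notin> cl_args C i" using args_bounds by blast
  then show ?thesis using ordinary by (simp add: eqn_H(3) set_deriv_snd[of _ _ _ _ i] restrict_set_deriv)
qed (auto simp: eqn_H set_deriv_snd set_deriv_def)

lemma dom_H_diag:
  assumes i: "i \<in> {1..N}" and p: "p \<in> dae_dom H i"
  shows "set_deriv p i (nat (1 - c i)) s \<in> dae_dom H i"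
  using i
proof (cases rule: row_cases)
  case sub
  then show ?thesis using p by (simp add: dom_H(3) block_vars_set_deriv)
next
  case ordinary
  then have "i \<notin> cl_args C i" using args_bounds by blast
  then show ?thesis using ordinary p by (simp add: dom_H(2) restrict_set_deriv)
qed (auto simp: dom_H)

lemma signature_le:
  assumes "i \<in> {1..N}"
  shows "signature H i j \<le> ereal (of_int (1 - c i))"
  unfolding signature_def
proof (rule SUP_least)
  fix k assume "k \<in> {k. occurs H i j k}"
  then have "real k \<le> of_int (1 - c i)" using occurs_H(1)[OF assms] by fastforce
  then show "ereal (real k) \<le> ereal (of_int (1 - c i))" by simp
qed

text \<open>Orders are integers, so missing the bound means lying at least 1 below it, and the
  inequality stays strict in the supremum. For \<open>c i = 1\<close> no order is left and the entry
  is minus infinity.\<close>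

lemma signature_upper:
  assumes "i \<in> {1..N}" "i < j"
  shows "signature H i j < ereal (of_int (1 - c i))"
proof -
  have "signature H i j \<le> ereal (of_int (- c i))"
    unfolding signature_def
  proof (rule SUP_least)
    fix k assume "k \<in> {k. occurs H i j k}"
    then have "int k \<le> 1 - c i" "int k \<noteq> 1 - c i"
      using occurs_H[OF assms(1), of j k] assms(2) by (simp, meson mem_Collect_eq not_less)
    then have "int k \<le> - c i" by linarith
    then have "real k \<le> of_int (- c i)" by linarith
    then show "ereal (real k) \<le> ereal (of_int (- c i))" by simp
  qed
  also have "\<dots> < ereal (of_int (1 - c i))" by simp
  finally show ?thesis .
qed

text \<open>
  If the domain of equation \<open>i\<close> were empty, no variable would occur in it and its signature row would be \<open>-\<infinity>\<close>.
\<close>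

lemma signature_diag:
  assumes i: "i \<in> {1..N}" and p: "p \<in> dae_dom H i"
  shows "signature H i i = ereal (of_int (1 - c i))"
proof (rule antisym[OF signature_le[OF i]])
  \<comment> \<open>Raising the leading derivative by 1 stays in the domain and raises the left-hand
    side by 1.\<close>
  have "occurs H i i (nat (1 - c i))"
    unfolding occurs_def
    using dom_H_diag[OF i p] eqn_H_diag[OF i, of p "snd p i (nat (1 - c i)) + 1"] p
    by (intro exI[of _ p] exI[of _ "snd p i (nat (1 - c i)) + 1"]) simp
  then have "ereal (real (nat (1 - c i))) \<le> signature H i i"
    unfolding signature_def by (intro SUP_upper) simp
  then show "ereal (of_int (1 - c i)) \<le> signature H i i" using c_le_1[of i] by simp
qed

lemma partial_diag:
  assumes "i \<in> {1..N}"
  shows "dae_partial H i i (nat (1 - c i)) p = 1"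
  unfolding dae_partial_def eqn_H_diag[OF assms]
  by (rule DERIV_imp_deriv) (auto intro!: derivative_eq_intros)

lemma transversal_diag: "transversal N {(i, i) | i. i \<in> {1..N}}"
  by (auto simp: transversal_def)

text \<open>A transversal meets each row exactly once, so \<open>fst\<close> maps it bijectively
  onto the rows.\<close>

lemma transversal_sum:
  assumes "transversal N T"
  shows "(\<Sum>(i, j)\<in>T. g i) = (\<Sum>i\<in>{1..N}. g i)"
proof -
  have "bij_betw fst T {1..N}"
  proof (rule bij_betw_imageI)
    show "inj_on fst T"
    proof (rule inj_onI, safe)
      fix i j j' i' assume "(i, j) \<in> T" "(i', j') \<in> T" "fst (i, j) = fst (i', j')"
      moreover from this have "\<exists>!j. (i, j) \<in> T" using assms by (auto simp: transversal_def)
      ultimately show "i = i'" "j = j'" by auto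
    qed
    show "fst ` T = {1..N}"
    proof
      show "fst ` T \<subseteq> {1..N}" using assms unfolding transversal_def by fastforce
      show "{1..N} \<subseteq> fst ` T"
      proof
        fix i assume "i \<in> {1..N}"
        then obtain j where "(i, j) \<in> T" using assms unfolding transversal_def by blast
        then show "i \<in> fst ` T" by force
      qed
    qed
  qed
  then show ?thesis by (simp add: case_prod_unfold sum.reindex_bij_betw)
qed

text \<open>The main diagonal is the transversal with equality; the domain point ensures that each
  diagonal entry is attained.\<close>

lemma offsets_valid:
  assumes "p \<in> dae_domain H"
  shows "valid_offsets H c (\<lambda>j. 1)"
proof -
  have "signature H i i = ereal (of_int (1 - c i))" if "i \<in> {1..N}" for i
    using assms that signature_diag[of i p] by (simp add: dae_domain_def)
  then have "\<forall>(i, j)\<in>{(i, i) | i. i \<in> {1..N}}. signature H i j = ereal (of_int (1 - c i))"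
    by blast
  then show ?thesis
    using signature_le transversal_diag unfolding valid_offsets_def size_H by blast
qed

lemma offsets_normalised: "normalised_offsets H c"
  unfolding normalised_offsets_def
proof (rule Min_eqI)
  \<comment> \<open>Row 1 is an ODE row because \<open>n\<close> is at least 1, so the value 0 is
    attained.\<close>
  have "1 \<in> ode_rows C" "1 \<in> {1..N}" using n_pos n_less_N by (auto simp: ode_rows_def)
  then show "0 \<in> c ` {1..dae_size H}" by (force simp: c_def)
qed (auto simp: c_def)

text \<open>The bound \<open>1 - c i\<close> is independent of the column, so every transversal has
  the same upper bound for its value, and the diagonal attains it.\<close>

lemma diag_highest_value:
  assumes p: "p \<in> dae_domain H"
  shows "highest_value_transversal H {(i, i) | i. i \<in> {1..N}}"
proof -
  let ?V = "\<Sum>i\<in>{1..N}. ereal (of_int (1 - c i))"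
  have le: "transversal_value H T \<le> ?V" if T: "transversal N T" for T
  proof -
    have "transversal_value H T \<le> (\<Sum>(i, j)\<in>T. ereal (of_int (1 - c i)))"
      unfolding transversal_value_def
    proof (rule sum_mono)
      fix x assume "x \<in> T"
      then have "fst x \<in> {1..N}" using T by (auto simp: transversal_def)
      then show "(case x of (i, j) \<Rightarrow> signature H i j) \<le> (case x of (i, j) \<Rightarrow> ereal (of_int (1 - c i)))"
        unfolding case_prod_unfold by (rule signature_le)
    qed
    then show ?thesis unfolding transversal_sum[OF T] .
  qed
  have "transversal_value H {(i, i) | i. i \<in> {1..N}} =
      (\<Sum>(i, j)\<in>{(i, i) | i. i \<in> {1..N}}. ereal (of_int (1 - c i)))"
    unfolding transversal_value_def
    using p signature_diag[of _ p] by (intro sum.cong) (auto simp: dae_domain_def)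
  then have eq: "transversal_value H {(i, i) | i. i \<in> {1..N}} = ?V"
    using transversal_sum[OF transversal_diag] by (simp only:)
  show ?thesis
    unfolding highest_value_transversal_def size_H eq
    using transversal_diag le by simp
qed

lemma jacobian_unit_lower_triangular:
  assumes p: "p \<in> dae_domain H"
  shows "unit_lower_triangular (system_jacobian H c (\<lambda>j. 1) p)"
proof -
  have "signature H (Suc i) (Suc i) = ereal (of_int (1 - c (Suc i)))" if "i < N" for i
    using p that signature_diag[of "Suc i" p] by (simp add: dae_domain_def)
  \<comment> \<open>Above the diagonal the test in \<open>system_jacobian\<close> fails, so those
    entries take the default 0.\<close>
  moreover have "ereal (of_int (1 - c (Suc i))) \<noteq> signature H (Suc i) (Suc j)" if "i < j" "j < N" for i j
    using signature_upper[of "Suc i" "Suc j"] that by auto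
  moreover have "dae_partial H (Suc i) (Suc i) (nat (1 - c (Suc i))) p = 1" if "i < N" for i
    using that by (intro partial_diag) auto
  ultimately show ?thesis
    unfolding unit_lower_triangular_def system_jacobian_def by (auto simp: Let_def)
qed

end

section \<open>A smooth solution of \<open>H\<close>, obtained by executing the code-list along a
  Picard solution\<close>

section \<open>Existence of consistent points\<close>

text \<open>The vectors are unrestricted outside \<open>A\<close>, so the bound also forces
  \<open>g\<close> to depend only on the coordinates in \<open>A\<close> near \<open>y0\<close>. The
  box is closed to match the Picard hypothesis.\<close>

definition Lipschitz_near ::
    "nat set \<Rightarrow> (nat \<Rightarrow> real) \<Rightarrow> real \<Rightarrow> real \<Rightarrow> ((nat \<Rightarrow> real) \<Rightarrow> real) \<Rightarrow> bool" where
  "Lipschitz_near A y0 d L g \<longleftrightarrow> 0 < d \<and> 0 \<le> L \<and>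
     (\<forall>y y'. (\<forall>k\<in>A. \<bar>y k - y0 k\<bar> \<le> d) \<longrightarrow> (\<forall>k\<in>A. \<bar>y' k - y0 k\<bar> \<le> d) \<longrightarrow>
        \<bar>g y - g y'\<bar> \<le> L * (\<Sum>k\<in>A. \<bar>y k - y' k\<bar>))"

lemma Lipschitz_near_mono:
  assumes "Lipschitz_near A y0 d L g" "0 < d'" "d' \<le> d" "L \<le> L'"
  shows "Lipschitz_near A y0 d' L' g"
  unfolding Lipschitz_near_def
proof (intro conjI allI impI)
  show "0 < d'" "0 \<le> L'" using assms by (auto simp: Lipschitz_near_def)
  fix y y' assume "\<forall>k\<in>A. \<bar>y k - y0 k\<bar> \<le> d'" "\<forall>k\<in>A. \<bar>y' k - y0 k\<bar> \<le> d'"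
  then have "\<forall>k\<in>A. \<bar>y k - y0 k\<bar> \<le> d" "\<forall>k\<in>A. \<bar>y' k - y0 k\<bar> \<le> d"
    using assms(3) by (meson order_trans)+
  then have "\<bar>g y - g y'\<bar> \<le> L * (\<Sum>k\<in>A. \<bar>y k - y' k\<bar>)"
    using assms(1) by (simp add: Lipschitz_near_def)
  also have "\<dots> \<le> L' * (\<Sum>k\<in>A. \<bar>y k - y' k\<bar>)"
    using assms(4) by (intro mult_right_mono sum_nonneg) auto
  finally show "\<bar>g y - g y'\<bar> \<le> L' * (\<Sum>k\<in>A. \<bar>y k - y' k\<bar>)" .
qed

lemma Lipschitz_near_common:
  assumes "finite J" "0 < e" "\<forall>j\<in>J. \<exists>d L. Lipschitz_near A y0 d L (g j)"
  obtains d L where "0 < d" "d < e" "0 \<le> L" "\<And>j. j \<in> J \<Longrightarrow> Lipschitz_near A y0 d L (g j)"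
proof -
  obtain D M where DM: "\<forall>j\<in>J. Lipschitz_near A y0 (D j) (M j) (g j)"
    using assms(3) by metis
  then have nn: "\<forall>j\<in>J. 0 < D j \<and> 0 \<le> M j" by (simp add: Lipschitz_near_def)
  \<comment> \<open>The entry \<open>e / 2\<close> forces \<open>d < e\<close> strictly and covers
    empty \<open>J\<close>.\<close>
  define d where "d = Min (insert (e / 2) (D ` J))"
  define L where "L = (\<Sum>j\<in>J. M j)"
  have d: "0 < d" "d < e" "\<And>j. j \<in> J \<Longrightarrow> d \<le> D j"
    using assms nn by (auto simp: d_def Min_less_iff)
  have L: "0 \<le> L" "\<And>j. j \<in> J \<Longrightarrow> M j \<le> L"
    using assms nn by (auto simp: L_def intro: sum_nonneg member_le_sum)
  show ?thesis using that[OF d(1,2) L(1)] DM d L Lipschitz_near_mono by metis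
qed

text \<open>The assignment clause of \<open>code_list_of_ode\<close>, separated from the inputs so
  that it can be asserted of the values of a curve at each time.\<close>

definition executes :: "code_list \<Rightarrow> (nat \<Rightarrow> real) \<Rightarrow> bool" where
  "executes C v \<longleftrightarrow> (\<forall>j\<in>{cl_n C + 2..cl_N C}. restrict v (cl_args C j) \<in> cl_dom C j \<and>
     v j = cl_fun C j (restrict v (cl_args C j)))"

text \<open>State and time are merged into one vector with time at index \<open>n + 1\<close>. The
  map \<open>V\<close> is a pointwise choice of execution; its regularity is established
  separately.\<close>

lemma code_list_of_ode_local:
  assumes "code_list_of_ode C \<Omega> f"
  obtains e y0 V where "e > 0"
    "\<And>y i. \<forall>k\<in>{1..cl_n C + 1}. \<bar>y k - y0 k\<bar> < e \<Longrightarrow> i \<in> {1..cl_n C + 1} \<Longrightarrow> V y i = y i"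
    "\<And>y. \<forall>k\<in>{1..cl_n C + 1}. \<bar>y k - y0 k\<bar> < e \<Longrightarrow> executes C (V y)"
proof -
  let ?n = "cl_n C" and ?P = "powertop_real {1..cl_n C}"
  obtain t0 x0 where tx: "(t0, x0) \<in> \<Omega>" and op: "openin (prod_topology euclideanreal ?P) \<Omega>"
    using assms by (fastforce simp: code_list_of_ode_def)
  from op[unfolded openin_prod_topology_alt, rule_format, OF tx]
  obtain U W where U: "open U" "t0 \<in> U" and W: "openin ?P W" "x0 \<in> W" and UW: "U \<times> W \<subseteq> \<Omega>"
    by auto
  obtain e1 where e1: "e1 > 0" "\<And>t. \<bar>t - t0\<bar> < e1 \<Longrightarrow> t \<in> U"
    using U unfolding open_dist dist_real_def by blast
  obtain e2 where e2: "e2 > 0" "ebox {1..?n} x0 e2 \<subseteq> W"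
    using openin_powertop_ebox[OF W(1) _ W(2)] by auto
  define y0 where "y0 = x0(?n + 1 := t0)"
  let ?near = "\<lambda>y. \<forall>k\<in>{1..?n + 1}. \<bar>y k - y0 k\<bar> < min e1 e2"
  have "\<exists>v. (\<forall>i\<in>{1..?n + 1}. v i = y i) \<and> executes C v" if y: "?near y" for y
  proof -
    have "y (?n + 1) \<in> U" using bspec[OF y, of "?n + 1"] by (intro e1(2)) (simp add: y0_def)
    moreover have "restrict y {1..?n} \<in> W"
    proof (intro subsetD[OF e2(2)])
      have "\<bar>y i - x0 i\<bar> < e2" if "i \<in> {1..?n}" for i
        using bspec[OF y, of i] that by (simp add: y0_def)
      then show "restrict y {1..?n} \<in> ebox {1..?n} x0 e2" by (simp add: ebox_def)
    qed
    ultimately have "(y (?n + 1), restrict y {1..?n}) \<in> \<Omega>" using UW by blast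
    then obtain v where v: "\<forall>i\<in>{1..?n}. v i = restrict y {1..?n} i" "v (?n + 1) = y (?n + 1)"
      "executes C v"
      using assms unfolding code_list_of_ode_def executes_def by blast
    have "v i = y i" if "i \<in> {1..?n + 1}" for i
      using that v(1,2) by (cases "i = ?n + 1") auto
    then show ?thesis using v(3) by blast
  qed
  then obtain V where "\<And>y. ?near y \<Longrightarrow> (\<forall>i\<in>{1..?n + 1}. V y i = y i) \<and> executes C (V y)"
    by metis
  then show ?thesis using e1(1) e2(1) by (intro that[of "min e1 e2" y0 V]) auto
qed

context code_list_replacement
begin

text \<open>Soundness allows strong induction on \<open>j\<close>: inputs are coordinates, and every
  later value composes a C^1 function with values already known to be Lipschitz near
  \<open>y0\<close>.\<close>

lemma execution_locally_Lipschitz: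
  assumes e: "e > 0"
    and V: "\<And>y i. \<forall>k\<in>{1..n+1}. \<bar>y k - y0 k\<bar> < e \<Longrightarrow> i \<in> {1..n+1} \<Longrightarrow> V y i = y i"
    and ex: "\<And>y. \<forall>k\<in>{1..n+1}. \<bar>y k - y0 k\<bar> < e \<Longrightarrow> executes C (V y)"
    and j: "j \<in> {1..N}"
  shows "\<exists>d L. Lipschitz_near {1..n+1} y0 d L (\<lambda>y. V y j)"
  using j
proof (induction j rule: less_induct)
  case (less j)
  let ?A = "{1..n+1}"
  let ?near = "\<lambda>d y. \<forall>k\<in>?A. \<bar>y k - y0 k\<bar> \<le> d"
  let ?S = "\<lambda>y y'. \<Sum>k\<in>?A. \<bar>y k - y' k\<bar>"
  have lt: "\<forall>k\<in>?A. \<bar>y k - y0 k\<bar> < e" if "?near d y" "d < e" for y d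
    using that by force
  show ?case
  proof (cases "j \<le> n + 1")
    case True
    then have jA: "j \<in> ?A" using less.prems by auto
    have "\<bar>V y j - V y' j\<bar> \<le> 1 * ?S y y'" if "?near (e/2) y" "?near (e/2) y'" for y y'
    proof -
      have "\<bar>y j - y' j\<bar> \<le> ?S y y'"
        by (rule member_le_sum[OF jA, where f = "\<lambda>k. \<bar>y k - y' k\<bar>"]) auto
      moreover have "V y j = y j" "V y' j = y' j"
        using V[OF lt[OF that(1)] jA] V[OF lt[OF that(2)] jA] e by auto
      ultimately show ?thesis by simp
    qed
    then have "Lipschitz_near ?A y0 (e / 2) 1 (\<lambda>y. V y j)"
      using e unfolding Lipschitz_near_def by simp
    then show ?thesis by blast
  next
    case False
    then have j: "j \<in> {n+2..N}" using less.prems by auto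
    let ?I = "cl_args C j" and ?\<phi> = "cl_fun C j"
    let ?w = "\<lambda>y. restrict (V y) (cl_args C j)"
    have near0: "?near d y0" if "d \<ge> 0" for d using that by simp
    have "cont_diff (Suc 0) ?I (cl_dom C j) ?\<phi>" "openin (powertop_real ?I) (cl_dom C j)"
      using smooth_fun[OF j] unfolding smooth_def by blast+
    moreover have "?w y0 \<in> cl_dom C j"
      using ex[OF lt[OF near0[of 0]]] e j by (auto simp: executes_def)
    ultimately obtain r M where r: "r > 0" and M: "M \<ge> 0"
      and lip: "\<And>u u'. u \<in> ebox ?I (?w y0) r \<Longrightarrow> u' \<in> ebox ?I (?w y0) r \<Longrightarrow>
          \<bar>?\<phi> u - ?\<phi> u'\<bar> \<le> M * (\<Sum>i\<in>?I. \<bar>u i - u' i\<bar>)"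
      using cont_diff_locally_Lipschitz finite_args by blast
    have LN: "\<forall>i\<in>?I. \<exists>d L. Lipschitz_near ?A y0 d L (\<lambda>y. V y i)"
    proof
      fix i assume "i \<in> ?I"
      then have "i < j" "i \<in> {1..N}" using args_bounds[of i j] j by auto
      then show "\<exists>d L. Lipschitz_near ?A y0 d L (\<lambda>y. V y i)" by (rule less.IH)
    qed
    obtain d' K where d': "0 < d'" "d' < e" and K: "0 \<le> K"
      and LK: "\<And>i. i \<in> ?I \<Longrightarrow> Lipschitz_near ?A y0 d' K (\<lambda>y. V y i)"
      by (rule Lipschitz_near_common[OF finite_args e LN]) (rule that)
    \<comment> \<open>Moving each input by at most \<open>q\<close> moves the arguments by at most
      \<open>K * (n + 1) * q < r\<close>, which keeps them in the box where the elementary function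
      is Lipschitz.\<close>
    define q where "q = r / (K * (n + 1) + 1)"
    define d where "d = min d' q"
    have pos: "K * (n + 1) + 1 > 0" using K by (intro add_nonneg_pos) auto
    have q: "q > 0" using r pos by (simp add: q_def)
    then have d: "0 < d" "d < e" "d \<le> q" "d \<le> d'" using d' by (auto simp: d_def)
    have VL: "\<bar>V y i - V y' i\<bar> \<le> K * ?S y y'" if "i \<in> ?I" "?near d y" "?near d y'" for i y y'
    proof -
      have "?near d' y" "?near d' y'" using that(2,3) d(4) by (meson order_trans)+
      then show ?thesis using LK[OF that(1)] by (simp add: Lipschitz_near_def)
    qed
    have box: "?w y \<in> ebox ?I (?w y0) r" if y: "?near d y" for y
    proof -
      have "\<bar>V y i - V y0 i\<bar> < r" if i: "i \<in> ?I" for i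
      proof -
        have S: "?S y y0 \<le> (n + 1) * d"
          using sum_bounded_above[of ?A "\<lambda>k. \<bar>y k - y0 k\<bar>" d] y by simp
        have "\<bar>V y i - V y0 i\<bar> \<le> K * ?S y y0" using VL[OF i y near0] d(1) by simp
        also have "\<dots> \<le> K * ((n + 1) * d)" using S K by (rule mult_left_mono)
        also have "\<dots> \<le> K * ((n + 1) * q)" using d(3) K by (intro mult_left_mono) auto
        also have "\<dots> < (K * (n + 1) + 1) * q" using q by (simp add: algebra_simps)
        also have "\<dots> = r" using pos by (simp add: q_def)
        finally show ?thesis .
      qed
      then show ?thesis by (simp add: ebox_def)
    qed
    have "\<bar>V y j - V y' j\<bar> \<le> (M * (card ?I * K)) * ?S y y'" if y: "?near d y" "?near d y'" for y y'
    proof -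
      have "V y j = ?\<phi> (?w y)" "V y' j = ?\<phi> (?w y')"
        using ex[OF lt[OF y(1) d(2)]] ex[OF lt[OF y(2) d(2)]] j by (auto simp: executes_def)
      then have "\<bar>V y j - V y' j\<bar> \<le> M * (\<Sum>i\<in>?I. \<bar>?w y i - ?w y' i\<bar>)"
        using lip[OF box[OF y(1)] box[OF y(2)]] by (simp only:)
      also have "\<dots> \<le> M * (card ?I * (K * ?S y y'))"
        using VL y by (intro mult_left_mono[OF _ M] sum_bounded_above) simp
      finally show ?thesis by (simp only: mult.assoc)
    qed
    then have "Lipschitz_near ?A y0 d (M * (card ?I * K)) (\<lambda>y. V y j)"
      using d(1) M K unfolding Lipschitz_near_def by simp
    then show ?thesis by blast
  qed
qed

text \<open>Each assignment in a block reads only the block argument, so an execution places the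
  block on the graph of \<open>g\<close>, where the identity defining \<open>h\<close> is
  available.\<close>

lemma block_vars_graph:
  assumes ex: "executes C (\<lambda>j. z j 0)" and J: "J \<in> r_blocks R"
  shows "block_vars R J z = block_graph C R J (z (r_arg R J) 0)"
    and "\<forall>j\<in>J. scalar_arg R J (z (r_arg R J) 0) \<in> cl_dom C j"
    and "\<forall>j\<in>J. z j 0 = cl_fun C j (scalar_arg R J (z (r_arg R J) 0))"
proof -
  have s: "scalar_arg R J (z (r_arg R J) 0) = restrict (\<lambda>j. z j 0) {r_arg R J}"
    by (auto simp: scalar_arg_def restrict_def)
  have *: "restrict (\<lambda>j. z j 0) {r_arg R J} \<in> cl_dom C j \<and>
      z j 0 = cl_fun C j (restrict (\<lambda>j. z j 0) {r_arg R J})" if "j \<in> J" for j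
  proof -
    have "j \<in> {n+2..N}" using block_subset[OF J] that by blast
    then have "restrict (\<lambda>j. z j 0) (cl_args C j) \<in> cl_dom C j \<and>
        z j 0 = cl_fun C j (restrict (\<lambda>j. z j 0) (cl_args C j))"
      using ex unfolding executes_def by blast
    then show ?thesis by (simp only: block_args[OF J that])
  qed
  show "\<forall>j\<in>J. scalar_arg R J (z (r_arg R J) 0) \<in> cl_dom C j"
    and val: "\<forall>j\<in>J. z j 0 = cl_fun C j (scalar_arg R J (z (r_arg R J) 0))"
    unfolding s using * by blast+
  show "block_vars R J z = block_graph C R J (z (r_arg R J) 0)"
    unfolding block_vars_def block_graph_def
    using val by (intro restrict_ext) auto
qed

text \<open>Bootstrapping needs two inductions. The outer one, on \<open>k\<close>, gives the state
  variables one more derivative, since their derivatives are outputs of arbitrary index; the inner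
  one, on \<open>j\<close>, passes this gain along the code-list.\<close>

lemma curves_smooth:
  assumes S: "open S" and ex: "\<And>t. t \<in> S \<Longrightarrow> executes C (\<lambda>j. X j t)"
    and time: "\<And>t. t \<in> S \<Longrightarrow> X (n+1) t = t"
    and ode: "\<And>i t. i \<in> {1..n} \<Longrightarrow> t \<in> S \<Longrightarrow> (X i has_real_derivative X (cl_out C i) t) (at t)"
    and j: "j \<in> {1..N}"
  shows "times_diff k S (X j)"
  using j
proof (induction k arbitrary: j)
  case (Suc k)
  have ode_vars: "times_diff (Suc k) S (X i)" if "i \<in> {1..n}" for i
    using times_diff_SucI[OF S ode[OF that] Suc.IH[OF out_bounds[OF that]]] .
  have time_var: "times_diff (Suc k) S (X (n+1))"
    using time by (intro times_diff_cong[OF S _ times_diff_ident[OF S]]) simp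
  show ?case using Suc.prems
  proof (induction j rule: less_induct)
    case (less j)
    consider "j \<in> {1..n}" | "j = n + 1" | "j \<in> {n+2..N}" using less.prems by force
    then show ?case
    proof cases
      case 3
      let ?I = "cl_args C j"
      have "cont_diff (Suc k) ?I (cl_dom C j) (cl_fun C j)" "openin (powertop_real ?I) (cl_dom C j)"
        using smooth_fun[OF 3] unfolding smooth_def by blast+
      moreover have "restrict (\<lambda>i. X i t) ?I \<in> cl_dom C j"
          "X j t = cl_fun C j (restrict (\<lambda>i. X i t) ?I)" if "t \<in> S" for t
        using ex[OF that] 3 by (auto simp: executes_def)
      moreover have "times_diff (Suc k) S (X i)" if "i \<in> ?I" for i
        using args_bounds[OF that] by (intro less.IH) auto
      ultimately have td: "times_diff (Suc k) S (\<lambda>t. cl_fun C j (restrict (\<lambda>i. X i t) ?I))"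
        and eq: "\<And>t. t \<in> S \<Longrightarrow> cl_fun C j (restrict (\<lambda>i. X i t) ?I) = X j t"
        using finite_args by (auto intro!: times_diff_compose[OF S])
      from times_diff_cong[OF S eq td] show ?thesis .
    qed (use ode_vars time_var in auto)
  qed
qed simp

lemma curves_solve:
  assumes S: "open S" "is_interval S" "S \<noteq> {}"
    and ex: "\<And>t. t \<in> S \<Longrightarrow> executes C (\<lambda>j. X j t)"
    and time: "\<And>t. t \<in> S \<Longrightarrow> X (n+1) t = t"
    and ode: "\<And>i t. i \<in> {1..n} \<Longrightarrow> t \<in> S \<Longrightarrow> (X i has_real_derivative X (cl_out C i) t) (at t)"
  shows "dae_solution H S X"
proof -
  have diff: "(deriv ^^ k) (X j) differentiable at t" if "j \<in> {1..N}" "t \<in> S" for j k t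
    using curves_smooth[OF S(1) ex time ode that(1), of "Suc k"] that(2)
    by (simp add: times_diff_def)
  have dom_eqn: "(t, jet_of X t) \<in> dae_dom H i \<and> dae_eqn H i (t, jet_of X t) = 0"
    if t: "t \<in> S" and i: "i \<in> {1..N}" for t i
    using i
  proof (cases rule: row_cases)
    case ode
    then show ?thesis using assms(6)[OF ode(1) t]
      by (simp add: dom_H eqn_H jet_of_def DERIV_imp_deriv)
  next
    case time
    then show ?thesis using assms(5)[OF t] by (simp add: dom_H eqn_H jet_of_def)
  next
    case ordinary
    then show ?thesis using ex[OF t] by (simp add: dom_H(2) eqn_H(3) jet_of_def executes_def)
  next
    case sub
    define J where "J = block_of R i"
    define r where "r = r_arg R J"
    have J: "J \<in> r_blocks R" "i \<in> J" using block_of[OF sub(1)] by (auto simp: J_def)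
    have r: "r \<in> {1..N}"
      using args_bounds[of r i] block_args[OF J] sub(2) by (auto simp: r_def)
    have exJ: "executes C (\<lambda>j. jet_of X s j 0)" if "s \<in> S" for s
      using ex[OF that] by (simp add: jet_of_def)
    note g = block_vars_graph[where z = "jet_of X s" for s, OF exJ J(1), folded r_def]
    have dom: "\<forall>j\<in>J. scalar_arg R J (X r t) \<in> cl_dom C j" using g(2)[OF t] by (simp add: jet_of_def)
    have bv: "block_vars R J (jet_of X t) = block_graph C R J (X r t)"
      using g(1)[OF t] by (simp add: jet_of_def)
    have Xi: "X i s = cl_fun C i (scalar_arg R J (X r s))" if "s \<in> S" for s
      using g(3)[OF that] J(2) by (simp add: jet_of_def)
    have "(X r has_real_derivative deriv (X r) t) (at t)"
      using diff[OF r t, of 0] by (simp add: DERIV_deriv_iff_real_differentiable)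
    \<comment> \<open>This is g'(u) = h(u, g(u)) at \<open>u = X r t\<close>, composed with
      \<open>X r\<close>; openness of \<open>S\<close> then transfers the derivative to
      \<open>X i\<close>.\<close>
    from DERIV_chain2[OF block_graph(2)[OF J(1) dom J(2)] this]
    have "(X i has_real_derivative r_fun R i (block_graph C R J (X r t)) * deriv (X r) t) (at t)"
      by (rule has_field_derivative_transform_within_open[OF _ S(1) t]) (simp add: Xi)
    then show ?thesis
      using block_graph(1)[OF J(1) dom] sub(1) bv
      by (simp add: dom_H(3) eqn_H(4) J_def[symmetric] r_def[symmetric])
        (simp add: jet_of_def DERIV_imp_deriv)
  qed
  show ?thesis
    unfolding dae_solution_def dae_domain_def size_H
    using S diff dom_eqn by blast
qed

lemma consistent_point_exists:
  assumes "code_list_of_ode C \<Omega> f"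
  obtains p where "consistent_point H p"
proof -
  let ?A = "{1..n+1}"
  obtain e y0 V where e: "e > 0"
    and V: "\<And>y i. \<forall>k\<in>?A. \<bar>y k - y0 k\<bar> < e \<Longrightarrow> i \<in> ?A \<Longrightarrow> V y i = y i"
    and ex: "\<And>y. \<forall>k\<in>?A. \<bar>y k - y0 k\<bar> < e \<Longrightarrow> executes C (V y)"
    using code_list_of_ode_local[OF assms] by blast
  have LN: "\<forall>j\<in>{1..N}. \<exists>d L. Lipschitz_near ?A y0 d L (\<lambda>y. V y j)"
    using execution_locally_Lipschitz[OF e V ex] by blast
  obtain d K where d: "0 < d" "d < e" and K: "0 \<le> K"
    and LK: "\<And>j. j \<in> {1..N} \<Longrightarrow> Lipschitz_near ?A y0 d K (\<lambda>y. V y j)"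
    by (rule Lipschitz_near_common[OF finite_atLeastAtMost e LN]) (rule that)
  \<comment> \<open>Coordinate \<open>n + 1\<close> is a clock of speed 1, which makes the system
    autonomous; the other components read the outputs of the execution.\<close>
  define F where "F = (\<lambda>i y. if i = n + 1 then 1 else V y (cl_out C i))"
  have lip: "\<bar>F i y - F i y'\<bar> \<le> K * (\<Sum>k\<in>?A. \<bar>y k - y' k\<bar>)"
    if "i \<in> ?A" "\<forall>k\<in>?A. \<bar>y k - y0 k\<bar> \<le> d" "\<forall>k\<in>?A. \<bar>y' k - y0 k\<bar> \<le> d" for i y y'
  proof (cases "i = n + 1")
    case True
    then show ?thesis using K by (simp add: F_def sum_nonneg)
  next
    case False
    then have "cl_out C i \<in> {1..N}" using out_bounds[of i] that(1) by simp
    from LK[OF this] show ?thesis using that False by (simp add: F_def Lipschitz_near_def)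
  qed
  \<comment> \<open>Starting at the initial clock value makes \<open>x_(n+1)\<close> equal to
    \<open>t\<close> rather than a shift of it.\<close>
  define a where "a = y0 (n + 1)"
  obtain \<delta> Y where \<delta>: "\<delta> > 0"
    and near: "\<And>i t. i \<in> ?A \<Longrightarrow> t \<in> {a..a+\<delta>} \<Longrightarrow> \<bar>Y i t - y0 i\<bar> \<le> d"
    and cont: "\<And>i. i \<in> ?A \<Longrightarrow> continuous_on {a..a+\<delta>} (\<lambda>s. F i (\<lambda>k. Y k s))"
    and int: "\<And>i t. i \<in> ?A \<Longrightarrow> t \<in> {a..a+\<delta>} \<Longrightarrow>
        Y i t = y0 i + integral {a..t} (\<lambda>s. F i (\<lambda>k. Y k s))"
    by (rule picard_existence[of ?A d K y0 F a, OF _ d(1) K lip]) auto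
  \<comment> \<open>Only the interior of the Picard interval is kept, so that derivatives within the
    closed interval become two-sided.\<close>
  define S where "S = {a<..<a+\<delta>}"
  \<comment> \<open>Executing the code-list along \<open>Y\<close> supplies all \<open>N\<close>
    variables; on \<open>S\<close> it returns \<open>Y\<close> itself for state and time.\<close>
  define X where "X = (\<lambda>j t. V (\<lambda>k. Y k t) j)"
  have near': "\<forall>k\<in>?A. \<bar>Y k t - y0 k\<bar> < e" if "t \<in> S" for t
  proof
    fix k assume "k \<in> ?A"
    moreover have "t \<in> {a..a+\<delta>}" using that by (simp add: S_def)
    ultimately show "\<bar>Y k t - y0 k\<bar> < e" using near d(2) by (meson le_less_trans)
  qed
  have XY: "X i t = Y i t" if "i \<in> ?A" "t \<in> S" for i t
    unfolding X_def using V[OF near'[OF that(2)] that(1)] .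
  have S: "open S" "is_interval S" "S \<noteq> {}"
    using \<delta> by (auto simp: S_def is_interval_oo)
  have "dae_solution H S X"
  proof (rule curves_solve[OF S])
    show "executes C (\<lambda>j. X j t)" if "t \<in> S" for t
      unfolding X_def using ex[OF near'[OF that]] .
    show "X (n+1) t = t" if t: "t \<in> S" for t
    proof -
      have "Y (n+1) t = a + integral {a..t} (\<lambda>s. 1)"
        using int[of "n+1" t] t by (simp add: F_def a_def S_def)
      then show ?thesis using XY[of "n+1" t] t by (simp add: S_def)
    qed
    fix i t assume i: "i \<in> {1..n}" and t: "t \<in> S"
    have iA: "i \<in> ?A" using i by simp
    let ?g = "\<lambda>s. F i (\<lambda>k. Y k s)"
    have "((\<lambda>x. integral {a..x} ?g) has_real_derivative ?g t) (at t within {a..a+\<delta>})"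
      using t by (intro integral_has_real_derivative cont iA) (auto simp: S_def)
    then have "((\<lambda>x. integral {a..x} ?g) has_real_derivative ?g t) (at t)"
      using t by (simp add: S_def at_within_Icc_at)
    then have "((\<lambda>x. y0 i + integral {a..x} ?g) has_real_derivative ?g t) (at t)"
      by (auto intro!: derivative_eq_intros)
    then have "(X i has_real_derivative ?g t) (at t)"
      by (rule has_field_derivative_transform_within_open[OF _ S(1) t])
        (use XY[OF iA] int[OF iA] in \<open>auto simp: S_def\<close>)
    moreover have "?g t = X (cl_out C i) t" using i by (simp add: F_def X_def)
    ultimately show "(X i has_real_derivative X (cl_out C i) t) (at t)" by simp
  qed
  then show ?thesis using S(3) that unfolding consistent_point_def by blast
qed

end

section \<open>Structural amenability\<close>

theorem theorem4p1:
  fixes C :: code_list and R :: replacement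
    and \<Omega> :: "(real \<times> (nat \<Rightarrow> real)) set"
    and f :: "real \<Rightarrow> (nat \<Rightarrow> real) \<Rightarrow> nat \<Rightarrow> real"
  assumes "code_list_of_ode C \<Omega> f"
    and "sub_ode_replacement C R"
  shows "let H = sub_ode_dae C R;
             c = (\<lambda>i. if i \<in> ode_rows C \<union> sub_ode_rows R then 0 else 1 :: int);
             d = (\<lambda>j. 1 :: int)
         in (valid_offsets H c d \<and> normalised_offsets H c) \<and>
            highest_value_transversal H {(i, i) | i. i \<in> {1..cl_N C}} \<and>
            (\<forall>p\<in>dae_domain H. unit_lower_triangular (system_jacobian H c d p) \<and>
                              invertible_mat (system_jacobian H c d p)) \<and>
            structurally_amenable H"
proof -
  interpret code_list_replacement C R
    using assms by unfold_locales (simp_all add: code_list_of_ode_def)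
  \<comment> \<open>This point serves twice: it shows that the domain is nonempty, as the diagonal
    signature requires, and it is where the Jacobian must be nonsingular for amenability.\<close>
  obtain p where p: "consistent_point H p" using consistent_point_exists[OF assms(1)] .
  then have dom: "p \<in> dae_domain H"
    by (auto simp: consistent_point_def dae_solution_def)
  have inv: "invertible_mat (system_jacobian H c (\<lambda>j. 1) p)" if "p \<in> dae_domain H" for p
    using invertible_unit_lower_triangular jacobian_unit_lower_triangular[OF that] .
  have "structurally_amenable H"
    unfolding structurally_amenable_def using offsets_valid[OF dom] p inv[OF dom] by blast
  then show ?thesis
    unfolding Let_def c_def[symmetric]
    using offsets_valid[OF dom] offsets_normalised diag_highest_value[OF dom]
      jacobian_unit_lower_triangular inv by blast
qed

end
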